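(* Let $\mathbb{K}$ be a field, let $G$ be a non-bipartite graph with vertex set $\{v_1,\dots,v_n\}$, and let $I=I(G)\subseteq S=\mathbb{K}[x_1,\dots,x_n]$ be its edge ideal. Suppose that $p$ is the number of bipartite connected components of $G$. Then for every integer $k\geq 1$, we have $\mathrm{sdepth}(I^k)\geq p+1$.
   Context: Graphs are finite and simple. The edge ideal $I(G)$ is the ideal of $S=\mathbb{K}[x_1,\dots,x_n]$ generated by the squarefree monomials $x_ix_j$ with $\{v_i,v_j\}$ an edge of $G$. An isolated vertex counts as a bipartite connected component. Stanley depth: let $M$ be a finitely generated $\mathbb{Z}^n$-graded $S$-module, $u\in M$ a homogeneous element and $Z\subseteq\{x_1,\dots,x_n\}$. The $\mathbb{K}$-subspace $u\mathbb{K}[Z]$ generated by all $uv$ with $v\in\mathbb{K}[Z]$ is called a Stanley space of dimension $|Z|$ if it is a free $\mathbb{K}[Z]$-module. A Stanley decomposition $\mathcal{D}$ of $M$ is a decomposition of $M$ (as a $\mathbb{K}$-vector space) as a finite direct sum of Stanley spaces; $\mathrm{sdepth}(\mathcal{D})$ is the minimum dimension of a Stanley space in $\mathcal{D}$, and $\mathrm{sdepth}(M)$ is the maximum of $\mathrm{sdepth}(\mathcal{D})$ over all Stanley decompositions $\mathcal{D}$ of $M$. *)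

theory Defs
  imports Graph_Theory.Graph_Theory "HOL-Library.Poly_Mapping" "HOL-Library.FuncSet"
begin

section \<open>Graphs\<close>

text \<open>
  Finite simple graphs are the symmetric, loop-free digraphs without parallel arcs of the locale
  \<open>graph\<close>: an edge \<open>{v, w}\<close> is the pair of arcs from \<open>v\<close> to \<open>w\<close> and from \<open>w\<close> to \<open>v\<close>. For such a
  digraph the strongly connected components \<open>pre_digraph.sccs\<close> (maximal strongly connected induced
  subgraphs) are the connected components of the graph.
\<close>

text \<open>
  A part may be empty, so a graph without edges, in particular an isolated vertex, is bipartite.
\<close>

definition bipartite :: "('v, 'e) pre_digraph \<Rightarrow> bool" where
  "bipartite G \<longleftrightarrow> (\<exists>A B. verts G = A \<union> B \<and> A \<inter> B = {} \<and>
     (\<forall>e\<in>arcs G. (tail G e \<in> A \<and> head G e \<in> B) \<or> (tail G e \<in> B \<and> head G e \<in> A)))"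


section \<open>Polynomials and ideals\<close>

text \<open>
  The polynomial ring over \<open>'k\<close> in variables indexed by a finite type \<open>'v\<close>: finitely supported
  coefficient functions on the exponent vectors.
\<close>

type_synonym ('v, 'k) mpoly = "('v \<Rightarrow>\<^sub>0 nat) \<Rightarrow>\<^sub>0 'k"

definition Var :: "'v \<Rightarrow> ('v, 'k::{zero_neq_one}) mpoly" where
  "Var x = Poly_Mapping.single (Poly_Mapping.single x 1) 1"

definition poly_subring :: "'v set \<Rightarrow> ('v, 'k::zero) mpoly set" where
  "poly_subring Z = {p. \<forall>t\<in>Poly_Mapping.keys p. Poly_Mapping.keys t \<subseteq> Z}"

text \<open>
  The component of degree \<open>a\<close> in the grading of the polynomial ring by integer vectors; it is zero
  if \<open>a\<close> has a negative entry.
\<close>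

definition degree_component :: "('v \<Rightarrow> int) \<Rightarrow> ('v, 'k::zero) mpoly set" where
  "degree_component a =
     {p. \<forall>t\<in>Poly_Mapping.keys p. \<forall>x. int (Poly_Mapping.lookup t x) = a x}"

lemma module_times: "module ((*) :: 'a::comm_ring_1 \<Rightarrow> 'a \<Rightarrow> 'a)"
  by unfold_locales (simp_all add: algebra_simps)

definition ideal_generated :: "'a::comm_ring_1 set \<Rightarrow> 'a set" where
  "ideal_generated = module.span (*)"

definition ideal_mult :: "'a::comm_ring_1 set \<Rightarrow> 'a set \<Rightarrow> 'a set" where
  "ideal_mult I J = ideal_generated {a * b | a b. a \<in> I \<and> b \<in> J}"

primrec ideal_power :: "'a::comm_ring_1 set \<Rightarrow> nat \<Rightarrow> 'a set" where
  "ideal_power I 0 = UNIV"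
| "ideal_power I (Suc k) = ideal_mult I (ideal_power I k)"

definition edge_ideal :: "('v, 'e) pre_digraph \<Rightarrow> ('v, 'k::comm_ring_1) mpoly set" where
  "edge_ideal G = ideal_generated {Var v * Var w | v w. v \<rightarrow>\<^bsub>G\<^esub> w}"


section \<open>Stanley depth\<close>

text \<open>
  In this section \<open>M\<close> is a graded submodule of a module over the polynomial ring with scalar
  multiplication \<open>scale\<close> and graded components \<open>gr a\<close>, where \<open>a\<close> is an integer vector.
  The homogeneous elements of \<open>M\<close> are the elements of the sets \<open>M \<inter> gr a\<close>.
\<close>

definition cyclic_span ::
    "(('v, 'k::zero) mpoly \<Rightarrow> 'm \<Rightarrow> 'm) \<Rightarrow> 'm \<Rightarrow> 'v set \<Rightarrow> 'm set" where
  "cyclic_span scale u Z = (\<lambda>v. scale v u) ` poly_subring Z"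

text \<open>
  The last conjunct says that \<open>{u}\<close> is a basis of \<open>cyclic_span scale u Z\<close> over the ring
  \<open>poly_subring Z\<close>. In particular \<open>u \<noteq> 0\<close>: the zero module, free of rank zero, does not count as
  a Stanley space.
\<close>

definition stanley_space ::
    "(('v, 'k::zero) mpoly \<Rightarrow> 'm \<Rightarrow> 'm) \<Rightarrow> (('v \<Rightarrow> int) \<Rightarrow> 'm::zero set) \<Rightarrow> 'm set
      \<Rightarrow> 'm \<Rightarrow> 'v set \<Rightarrow> bool" where
  "stanley_space scale gr M u Z \<longleftrightarrow>
     u \<in> M \<and> (\<exists>a. u \<in> gr a) \<and> (\<forall>v\<in>poly_subring Z. scale v u = 0 \<longrightarrow> v = 0)"

text \<open>
  The bijection says that \<open>M\<close> is the direct sum of the Stanley spaces: every element of \<open>M\<close>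
  is in exactly one way a sum of elements of these spaces, and all such sums lie in \<open>M\<close>.
\<close>

definition stanley_decomposition ::
    "(('v, 'k::zero) mpoly \<Rightarrow> 'm \<Rightarrow> 'm) \<Rightarrow> (('v \<Rightarrow> int) \<Rightarrow> 'm::comm_monoid_add set) \<Rightarrow> 'm set
      \<Rightarrow> ('m \<times> 'v set) set \<Rightarrow> bool" where
  "stanley_decomposition scale gr M D \<longleftrightarrow>
     finite D \<and> (\<forall>(u, Z)\<in>D. stanley_space scale gr M u Z) \<and>
     bij_betw (\<lambda>f. \<Sum>d\<in>D. f d) (\<Pi>\<^sub>E (u, Z)\<in>D. cyclic_span scale u Z) M"

definition sdepth_decomposition :: "('m \<times> 'v set) set \<Rightarrow> nat" where
  "sdepth_decomposition D = Min ((\<lambda>(u, Z). card Z) ` D)"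

text \<open>
  Meaningful for finitely generated \<open>M \<noteq> 0\<close> only. The maximum is over a finite set, since the
  dimensions are bounded by the number of variables.
\<close>

definition sdepth ::
    "(('v::finite, 'k::zero) mpoly \<Rightarrow> 'm \<Rightarrow> 'm) \<Rightarrow> (('v \<Rightarrow> int) \<Rightarrow> 'm::comm_monoid_add set)
      \<Rightarrow> 'm set \<Rightarrow> nat" where
  "sdepth scale gr M =
     Max {sdepth_decomposition D | D. stanley_decomposition scale gr M D}"

end

theory Submission
  imports Defs "HOL-Library.Multiset" "HOL-Library.Countable"
begin

text \<open>
  The exponents of the monomials in \<open>I\<^sup>k\<close> are the vectors \<open>t\<close> under which \<open>k\<close> edges can be packed,
  so a Stanley decomposition by monomials is a partition of this set into finitely many cones. Let
  \<open>e C t\<close> be the packing number of \<open>t\<close> on \<open>C\<close>, where \<open>C\<close> is a bipartite component or the union \<open>R\<close>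
  of the other ones. Fixing \<open>min (e C t) k\<close> for all \<open>C \<noteq> R\<close> leaves a lower bound on \<open>e R t\<close>,
  so the set is a disjoint union of products with \<open>p + 1\<close> factors, and it suffices to partition each
  factor into finitely many cones of dimension at least 1. This is possible for a level set of a
  monotone function that depends only on bounded entries, provided that from each of its points some
  coordinate can be increased forever without leaving the level set. For \<open>e R t \<ge> j\<close> every coordinate
  will do; for \<open>C\<close> a coordinate outside a minimum weight vertex cover does, by Koenig's theorem.
\<close>

section \<open>Koenig's theorem\<close>

text \<open>\<open>card\<close> of an infinite set is 0, so without finiteness infinite sets would
  pass for covers of size 0.\<close>

definition edge_cover :: "('a \<times> 'b) set \<Rightarrow> 'a set \<Rightarrow> 'b set \<Rightarrow> bool" where
  "edge_cover E X Y \<longleftrightarrow> finite X \<and> finite Y \<and> E \<subseteq> X \<times> UNIV \<union> UNIV \<times> Y"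

lemma edge_cover_converse: "edge_cover (E\<inverse>) Y X \<longleftrightarrow> edge_cover E X Y"
  by (auto simp: edge_cover_def)

text \<open>
  If two edges share a vertex, the covers left after deleting one or the other can be uncrossed to
  two covers of \<open>E\<close> that are together too small. So a graph in which every deletion lowers the cover
  number is a matching.
\<close>

lemma inj_on_fst_of_critical:
  assumes min: "\<And>X Y. edge_cover E X Y \<Longrightarrow> n \<le> card X + card Y"
    and critical: "\<And>e. e \<in> E \<Longrightarrow> \<exists>X Y. edge_cover (E - {e}) X Y \<and> card X + card Y < n"
  shows "inj_on fst E"
proof (rule ccontr)
  assume "\<not> inj_on fst E"
  then obtain a b b' where e: "(a, b) \<in> E" "(a, b') \<in> E" "b \<noteq> b'"
    unfolding inj_on_def by (metis prod.collapse)
  obtain X1 Y1 where c1: "edge_cover (E - {(a, b)}) X1 Y1" "card X1 + card Y1 < n"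
    using critical e by meson
  obtain X2 Y2 where c2: "edge_cover (E - {(a, b')}) X2 Y2" "card X2 + card Y2 < n"
    using critical e by meson
  have fin: "finite X1" "finite Y1" "finite X2" "finite Y2"
    using c1 c2 by (auto simp: edge_cover_def)
  have "a \<notin> X1"
  proof
    assume "a \<in> X1"
    then have "edge_cover E X1 Y1"
      using c1 by (auto simp: edge_cover_def)
    then show False using min c1(2) by fastforce
  qed
  moreover have "a \<notin> X2"
  proof
    assume "a \<in> X2"
    then have "edge_cover E X2 Y2"
      using c2 by (auto simp: edge_cover_def)
    then show False using min c2(2) by fastforce
  qed
  \<comment> \<open>Each of the two covers misses \<open>a\<close> but covers the edge that was not
    deleted, so it has to use the second end of that edge.\<close>
  ultimately have b: "b' \<in> Y1" "b \<in> Y2"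
    using e c1 c2 by (auto simp: edge_cover_def)
  have "edge_cover E (X1 \<inter> X2) (Y1 \<union> Y2)"
    unfolding edge_cover_def
  proof (intro conjI subsetI)
    fix z assume z: "z \<in> E"
    show "z \<in> (X1 \<inter> X2) \<times> UNIV \<union> UNIV \<times> (Y1 \<union> Y2)"
      using z b c1(1) c2(1) by (cases z) (auto simp: edge_cover_def)
  qed (use fin in auto)
  moreover have "edge_cover E (insert a (X1 \<union> X2)) (Y1 \<inter> Y2)"
    unfolding edge_cover_def
  proof (intro conjI subsetI)
    fix z assume z: "z \<in> E"
    show "z \<in> insert a (X1 \<union> X2) \<times> UNIV \<union> UNIV \<times> (Y1 \<inter> Y2)"
      using z c1(1) c2(1) by (cases z) (auto simp: edge_cover_def)
  qed (use fin in auto)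
  \<comment> \<open>Together the two covers have size at most
    \<open>card X1 + card Y1 + card X2 + card Y2 + 1\<close>, hence at most
    \<open>2 * n - 1\<close>, although each has size at least \<open>n\<close>.\<close>
  ultimately have "n \<le> card (X1 \<inter> X2) + card (Y1 \<union> Y2)"
    "n \<le> card (insert a (X1 \<union> X2)) + card (Y1 \<inter> Y2)"
    using min by blast+
  moreover have "card (X1 \<union> X2) + card (X1 \<inter> X2) = card X1 + card X2"
    "card (Y1 \<union> Y2) + card (Y1 \<inter> Y2) = card Y1 + card Y2"
    using card_Un_Int[OF fin(1,3)] card_Un_Int[OF fin(2,4)] by simp_all
  moreover have "card (insert a (X1 \<union> X2)) \<le> Suc (card (X1 \<union> X2))"
    by (rule card_insert_le_m1) auto
  ultimately show False
    using c1(2) c2(2) by linarith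
qed

text \<open>Let \<open>n\<close> be the cover number. If deleting some edge does not lower it, the
  induction hypothesis already yields a matching with at least \<open>n\<close> edges. Otherwise
  \<open>inj_on_fst_of_critical\<close>, applied to \<open>E\<close> and to its converse, makes
  \<open>E\<close> itself a matching; it has at least \<open>n\<close> edges because its first ends
  cover it.\<close>

theorem koenig:
  fixes E :: "('a \<times> 'b) set"
  assumes "finite E"
  shows "\<exists>M X Y. M \<subseteq> E \<and> inj_on fst M \<and> inj_on snd M \<and> edge_cover E X Y \<and>
    card X + card Y \<le> card M"
  using assms
proof (induction E rule: finite_psubset_induct)
  case (psubset E)
  define cov where "cov n \<longleftrightarrow> (\<exists>X Y. edge_cover E X Y \<and> card X + card Y = n)" for n
  have "edge_cover E (fst ` E) {}"
    using psubset.hyps by (force simp: edge_cover_def)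
  then have le: "cov (card (fst ` E))" unfolding cov_def by force
  define n where "n = (LEAST n. cov n)"
  have "cov n" unfolding n_def using le by (rule LeastI)
  then obtain X Y where XY: "edge_cover E X Y" "card X + card Y = n"
    by (auto simp: cov_def)
  have min: "n \<le> card X' + card Y'" if "edge_cover E X' Y'" for X' Y'
    unfolding n_def by (rule Least_le) (use that cov_def in blast)
  show ?case
  proof (cases "\<forall>e\<in>E. \<exists>X Y. edge_cover (E - {e}) X Y \<and> card X + card Y < n")
    case True
    have "inj_on fst E"
      by (rule inj_on_fst_of_critical[of _ n]) (use min True in auto)
    moreover have "inj_on fst (E\<inverse>)"
    proof (rule inj_on_fst_of_critical[of _ n])
      show "n \<le> card X + card Y" if "edge_cover (E\<inverse>) X Y" for X Y
        using that min[of Y X] by (simp add: edge_cover_converse)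
      fix e assume "e \<in> E\<inverse>"
      then have "prod.swap e \<in> E" by auto
      then obtain X Y where "edge_cover (E - {prod.swap e}) X Y" "card X + card Y < n"
        using True by blast
      moreover have "(E - {prod.swap e})\<inverse> = E\<inverse> - {e}" by (cases e) auto
      ultimately show "\<exists>X Y. edge_cover (E\<inverse> - {e}) X Y \<and> card X + card Y < n"
        by (metis add.commute edge_cover_converse)
    qed
    then have "inj_on snd E" unfolding inj_on_def by (metis converse.intros fst_conv prod.collapse snd_conv)
    moreover have "n \<le> card E"
      using min[OF \<open>edge_cover E (fst ` E) {}\<close>] card_image_le[OF psubset.hyps, of fst] by simp
    ultimately show ?thesis using XY by blast
  next
    case False
    then obtain e where e: "e \<in> E"
      and no: "\<And>X Y. edge_cover (E - {e}) X Y \<Longrightarrow> n \<le> card X + card Y"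
      by (meson not_less)
    obtain M X' Y' where M: "M \<subseteq> E - {e}" "inj_on fst M" "inj_on snd M"
      "edge_cover (E - {e}) X' Y'" "card X' + card Y' \<le> card M"
      using psubset.IH[of "E - {e}"] e by blast
    have "n \<le> card M" using no[OF M(4)] M(5) by simp
    then show ?thesis using XY M by blast
  qed
qed

section \<open>Packing edges under a vector\<close>

text \<open>With \<open>f\<close> reading off one end of an edge, a matching between copies
  \<open>(v, i)\<close>, \<open>i < t v\<close>, uses \<open>v\<close> at most \<open>t v\<close>
  times, since the copies used are distinct.\<close>

lemma card_fst_fibre_le:
  fixes f :: "'z \<Rightarrow> 'v \<times> nat"
  assumes inj: "inj_on f M" and less: "\<And>z. z \<in> M \<Longrightarrow> snd (f z) < t (fst (f z))"
  shows "card {z \<in> M. fst (f z) = v} \<le> t v"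
proof -
  have "inj_on (snd \<circ> f) {z \<in> M. fst (f z) = v}"
    using inj by (auto simp: inj_on_def prod_eq_iff)
  moreover have "(snd \<circ> f) ` {z \<in> M. fst (f z) = v} \<subseteq> {..<t v}"
    using less by auto
  ultimately have "card {z \<in> M. fst (f z) = v} \<le> card {..<t v}"
    by (rule card_inj_on_le) simp
  then show ?thesis by simp
qed

lemma count_image_mset_set:
  assumes "finite M"
  shows "count (image_mset f (mset_set M)) v = card {z \<in> M. f z = v}"
  using assms
proof (induction M rule: finite_induct)
  case (insert x F)
  have "{z \<in> insert x F. f z = v} = {z \<in> F. f z = v} \<union> (if f x = v then {x} else {})" by auto
  with insert show ?case by auto
qed simp

text \<open>The exponent of the variable \<open>v\<close> in the product of the edge monomials over
  all pairs in \<open>M\<close>.\<close>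

definition mult_deg :: "('v \<times> 'v) multiset \<Rightarrow> 'v \<Rightarrow> nat" where
  "mult_deg M v = count (image_mset fst M) v + count (image_mset snd M) v"

text \<open>The monomial with exponent vector \<open>t\<close> is divisible by a product of
  \<open>k\<close> edges. An edge may occur repeatedly in such a product, hence the
  multiset.\<close>

definition packs :: "('v \<times> 'v) set \<Rightarrow> nat \<Rightarrow> ('v \<Rightarrow> nat) \<Rightarrow> bool" where
  "packs E k t \<longleftrightarrow> (\<exists>M. set_mset M \<subseteq> E \<and> size M = k \<and> (\<forall>v. mult_deg M v \<le> t v))"

definition packing_number :: "('v \<times> 'v) set \<Rightarrow> ('v \<Rightarrow> nat) \<Rightarrow> nat" where
  "packing_number E t = Max {k. packs E k t}"

lemma mult_deg_empty [simp]: "mult_deg {#} v = 0"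
  by (simp add: mult_deg_def)

lemma mult_deg_add_mset:
  "mult_deg (add_mset (a, b) M) v = mult_deg M v + of_bool (a = v) + of_bool (b = v)"
  by (simp add: mult_deg_def)

lemma mult_deg_union: "mult_deg (M + N) v = mult_deg M v + mult_deg N v"
  by (simp add: mult_deg_def)

lemma mult_deg_mono: "M \<subseteq># N \<Longrightarrow> mult_deg M v \<le> mult_deg N v"
  by (auto simp: mset_subset_eq_exists_conv mult_deg_union)

lemma mult_deg_le: "mult_deg M v \<le> 2 * size M"
  unfolding mult_deg_def
  using count_le_size[of "image_mset fst M" v] count_le_size[of "image_mset snd M" v] by simp

text \<open>The handshake lemma: every pair is counted once at each of its two ends.\<close>

lemma sum_mult_deg:
  assumes "finite B" "set_mset M \<subseteq> B \<times> B"
  shows "(\<Sum>v\<in>B. mult_deg M v) = 2 * size M"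
proof -
  have "(\<Sum>v\<in>B. count (image_mset f M) v) = size M" if "f ` set_mset M \<subseteq> B" for f
  proof -
    have "(\<Sum>v\<in>B. count (image_mset f M) v) = (\<Sum>v\<in>set_mset (image_mset f M). count (image_mset f M) v)"
    proof (rule sum.mono_neutral_right)
      show "\<forall>v\<in>B - set_mset (image_mset f M). count (image_mset f M) v = 0"
        by (meson DiffD2 not_in_iff)
    qed (use that assms(1) in auto)
    then show ?thesis
      by (metis size_image_mset size_multiset_overloaded_eq)
  qed
  from this[of fst] this[of snd] assms(2) show ?thesis
    unfolding mult_deg_def sum.distrib by fastforce
qed

lemma size_le_sum_cover:
  assumes "finite C" "\<forall>(a, b)\<in>#M. a \<in> C \<or> b \<in> C"
  shows "size M \<le> (\<Sum>v\<in>C. mult_deg M v)"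
  using assms(2)
proof (induction M)
  case (add e M)
  obtain a b where e: "e = (a, b)" by force
  have "1 \<le> (\<Sum>v\<in>C. of_bool (a = v) + of_bool (b = v) :: nat)"
    using add.prems assms(1) by (auto simp: e sum.distrib of_bool_def sum.If_cases)
  with add assms(1) show ?case
    by (simp add: e mult_deg_add_mset sum.distrib)
qed simp

lemma packsI: "set_mset M \<subseteq> E \<Longrightarrow> (\<And>v. mult_deg M v \<le> t v) \<Longrightarrow> packs E (size M) t"
  unfolding packs_def by (rule exI[of _ M]) simp

lemma packsE:
  assumes "packs E k t"
  obtains M where "set_mset M \<subseteq> E" "size M = k" "\<And>v. mult_deg M v \<le> t v"
  using assms unfolding packs_def by blast

lemma packs_0 [simp]: "packs E 0 t"
  by (auto simp: packs_def)

lemma packs_antimono: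
  assumes "packs E k t" "l \<le> k"
  shows "packs E l t"
proof -
  obtain M where M: "set_mset M \<subseteq> E" "size M = k" "\<And>v. mult_deg M v \<le> t v"
    using assms by (auto elim: packsE)
  obtain xs where xs: "mset xs = M" using ex_mset by blast
  define N where "N = mset (take l xs)"
  have N: "N \<subseteq># M"
    unfolding N_def by (metis append_take_drop_id mset_append mset_subset_eq_add_left xs)
  have "size N = l" unfolding N_def using xs M(2) \<open>l \<le> k\<close> by auto
  moreover have "packs E (size N) t"
    using M(1) set_mset_mono[OF N] order_trans[OF mult_deg_mono[OF N] M(3)] by (intro packsI) auto
  ultimately show ?thesis by simp
qed

text \<open>Weak duality between packings and covers weighted by \<open>t\<close>: every packed edge
  uses up a unit at some vertex of \<open>C\<close>. Taking \<open>C = UNIV\<close> bounds the size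
  of all packings.\<close>

lemma packs_le_sum_cover:
  assumes "finite C" "\<forall>(a, b)\<in>E. a \<in> C \<or> b \<in> C" "packs E k t"
  shows "k \<le> (\<Sum>v\<in>C. t v)"
proof -
  obtain M where M: "set_mset M \<subseteq> E" "size M = k" "\<forall>v. mult_deg M v \<le> t v"
    using assms by (auto simp: packs_def)
  have "k \<le> (\<Sum>v\<in>C. mult_deg M v)"
    using size_le_sum_cover[of C M] M assms by blast
  also have "\<dots> \<le> (\<Sum>v\<in>C. t v)" using M by (intro sum_mono) auto
  finally show ?thesis .
qed

text \<open>The numbers \<open>k\<close> with \<open>packs E k t\<close> form a finite initial
  segment containing 0, so their maximum determines them.\<close>

lemma packs_iff: "packs E k t \<longleftrightarrow> k \<le> packing_number E t" for t :: "'v::finite \<Rightarrow> nat"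
proof -
  have "{k. packs E k t} \<subseteq> {..\<Sum>v\<in>UNIV. t v}"
    using packs_le_sum_cover[of UNIV E _ t] by auto
  then have "finite {k. packs E k t}" by (rule finite_subset) simp
  moreover from this have "packs E (packing_number E t) t"
    unfolding packing_number_def using Max_in[of "{k. packs E k t}"] packs_0 by blast
  ultimately show ?thesis
    unfolding packing_number_def by (metis Max_ge mem_Collect_eq packs_antimono)
qed

lemma packs_clamp:
  assumes "packs E k t" "2 * k \<le> g"
  shows "packs E k (\<lambda>v. min (t v) g)"
proof -
  obtain M where M: "set_mset M \<subseteq> E" "size M = k" "\<And>v. mult_deg M v \<le> t v"
    using assms by (auto elim: packsE)
  have "mult_deg M v \<le> min (t v) g" for v
    using M(2) M(3)[of v] mult_deg_le[of M v] assms(2) by simp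
  with M(1,2) show ?thesis using packsI[of M E "\<lambda>v. min (t v) g"] by simp
qed

lemma packs_mono_on:
  assumes "packs E k s" "E \<subseteq> B \<times> B" "\<And>v. v \<in> B \<Longrightarrow> s v \<le> t v"
  shows "packs E k t"
proof -
  obtain M where M: "set_mset M \<subseteq> E" "size M = k" "\<And>v. mult_deg M v \<le> s v"
    using assms by (auto elim: packsE)
  have "mult_deg M v = 0" if "v \<notin> B" for v
    using that M(1) assms(2) by (auto simp: mult_deg_def count_eq_zero_iff)
  then have "mult_deg M v \<le> t v" for v
    using M(3) assms(3) by (cases "v \<in> B") (auto intro: order_trans)
  with M show ?thesis using packsI by blast
qed

text \<open>The combinatorial form of the recursion for \<open>ideal_power\<close>: one edge is
  split off, and \<open>s\<close> is what remains of \<open>t\<close>.\<close>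

lemma packs_Suc_iff:
  "packs E (Suc k) t \<longleftrightarrow>
    (\<exists>(a, b)\<in>E. \<exists>s. packs E k s \<and> (\<forall>v. t v = s v + of_bool (a = v) + of_bool (b = v)))"
proof
  assume "packs E (Suc k) t"
  then obtain M where M: "set_mset M \<subseteq> E" "size M = Suc k" "\<And>v. mult_deg M v \<le> t v"
    by (auto elim: packsE)
  then obtain a b N where N: "M = add_mset (a, b) N"
    by (metis size_eq_Suc_imp_eq_union surj_pair)
  \<comment> \<open>By \<open>le\<close> the edge fits under \<open>t\<close>, so the subtraction
    does not truncate.\<close>
  let ?s = "\<lambda>v. t v - (of_bool (a = v) + of_bool (b = v))"
  have le: "mult_deg N v + (of_bool (a = v) + of_bool (b = v)) \<le> t v" for v
    using M(3)[of v] by (simp add: N mult_deg_add_mset)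
  then have "mult_deg N v \<le> ?s v" for v
    by (metis add_le_imp_le_diff)
  then have "packs E k ?s"
    using M packsI[of N E ?s] by (simp add: N)
  moreover have "t v = ?s v + of_bool (a = v) + of_bool (b = v)" for v
    using le[of v] by linarith
  moreover have "(a, b) \<in> E" using M by (auto simp: N)
  ultimately show "\<exists>(a, b)\<in>E. \<exists>s. packs E k s \<and> (\<forall>v. t v = s v + of_bool (a = v) + of_bool (b = v))"
    by blast
next
  assume "\<exists>(a, b)\<in>E. \<exists>s. packs E k s \<and> (\<forall>v. t v = s v + of_bool (a = v) + of_bool (b = v))"
  then obtain a b s M where "(a, b) \<in> E" "\<And>v. t v = s v + of_bool (a = v) + of_bool (b = v)"
    "set_mset M \<subseteq> E" "size M = k" "\<And>v. mult_deg M v \<le> s v"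
    by (auto elim!: packsE)
  then have "packs E (size (add_mset (a, b) M)) t"
    by (intro packsI) (auto simp: mult_deg_add_mset)
  then show "packs E (Suc k) t" using \<open>size M = k\<close> by simp
qed

text \<open>Different \<open>E q\<close> use disjoint sets of vertices, so in the union of the
  packings only the one for \<open>blk v\<close> contributes to the degree at
  \<open>v\<close>.\<close>

lemma packs_sum:
  assumes "finite Q" "\<And>q. q \<in> Q \<Longrightarrow> packs (E q) (k q) t"
    "\<And>q. q \<in> Q \<Longrightarrow> E q \<subseteq> blk -` {q} \<times> blk -` {q}"
  shows "packs (\<Union>q\<in>Q. E q) (\<Sum>q\<in>Q. k q) t"
proof -
  obtain M where M: "\<And>q. q \<in> Q \<Longrightarrow> set_mset (M q) \<subseteq> E q \<and> size (M q) = k q \<and> (\<forall>v. mult_deg (M q) v \<le> t v)"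
    using assms(2) unfolding packs_def by metis
  have sub: "set_mset (\<Sum>q\<in>R. M q) \<subseteq> (\<Union>q\<in>R. E q)" if "R \<subseteq> Q" for R
    using finite_subset[OF that assms(1)] that by (induction R rule: finite_induct) (use M in auto)
  have deg: "mult_deg (\<Sum>q\<in>R. M q) v = (if blk v \<in> R then mult_deg (M (blk v)) v else 0)" if "R \<subseteq> Q" for R v
    using finite_subset[OF that assms(1)] that
  proof (induction R rule: finite_induct)
    case (insert q R)
    have "mult_deg (M q) v = 0" if "q \<noteq> blk v"
      using that M[of q] assms(3)[of q] insert.prems by (fastforce simp: mult_deg_def count_eq_zero_iff)
    with insert show ?case by (auto simp: mult_deg_union)
  qed simp
  have "packs (\<Union>q\<in>Q. E q) (size (\<Sum>q\<in>Q. M q)) t"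
    by (rule packsI) (use sub[of Q] deg[of Q] M in auto)
  moreover have "size (\<Sum>q\<in>Q. M q) = (\<Sum>q\<in>Q. k q)"
    using M by (simp add: size_multiset_sum)
  ultimately show ?thesis by simp
qed

lemma packs_split:
  assumes "finite Q" "packs (\<Union>q\<in>Q. E q) k t" "\<And>q q'. q \<in> Q \<Longrightarrow> q' \<in> Q \<Longrightarrow> q \<noteq> q' \<Longrightarrow> E q \<inter> E q' = {}"
  shows "\<exists>l. (\<forall>q\<in>Q. packs (E q) (l q) t) \<and> (\<Sum>q\<in>Q. l q) = k"
proof -
  obtain M where M: "set_mset M \<subseteq> (\<Union>q\<in>Q. E q)" "size M = k" "\<And>v. mult_deg M v \<le> t v"
    using assms(2) by (auto elim: packsE)
  have "packs (E q) (size (filter_mset (\<lambda>e. e \<in> E q) M)) t" for q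
    by (rule packsI) (use M(3) mult_deg_mono[of "filter_mset (\<lambda>e. e \<in> E q) M" M] in \<open>auto intro: order_trans\<close>)
  moreover have "(\<Sum>q\<in>Q. size (filter_mset (\<lambda>e. e \<in> E q) N)) = size N" if "set_mset N \<subseteq> (\<Union>q\<in>Q. E q)" for N
    using that
  proof (induction N)
    case (add e N)
    then obtain q where q: "q \<in> Q" "e \<in> E q" by auto
    have *: "e \<in> E q' \<longleftrightarrow> q' = q" if "q' \<in> Q" for q' using that q assms(3) by blast
    then have "size (filter_mset (\<lambda>e. e \<in> E q') (add_mset e N)) =
      size (filter_mset (\<lambda>e. e \<in> E q') N) + (if q' = q then 1 else 0)" if "q' \<in> Q" for q'
      by (simp add: *[OF that])
    then show ?case using add q(1) assms(1) by (simp add: sum.distrib)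
  qed simp
  ultimately show ?thesis
    using M by (intro exI[of _ "\<lambda>q. size (filter_mset (\<lambda>e. e \<in> E q) M)"]) simp
qed

text \<open>The packing number is additive over blocks with no edges between them: a packing
  restricts to every block, and optimal packings of the blocks can be united.\<close>

lemma packs_blocks_iff:
  fixes t :: "'v::finite \<Rightarrow> nat"
  assumes "finite Q" "range blk \<subseteq> Q" "\<And>a b. (a, b) \<in> E \<Longrightarrow> blk a = blk b"
  shows "packs E k t \<longleftrightarrow> k \<le> (\<Sum>q\<in>Q. packing_number {e \<in> E. blk (fst e) = q} t)"
proof -
  let ?E = "\<lambda>q. {e \<in> E. blk (fst e) = q}"
  have E: "E = (\<Union>q\<in>Q. ?E q)" using assms(2) by auto
  have sub: "?E q \<subseteq> blk -` {q} \<times> blk -` {q}" for q using assms(3) by auto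
  show ?thesis
  proof
    assume "packs E k t"
    then obtain l where "\<forall>q\<in>Q. packs (?E q) (l q) t" "(\<Sum>q\<in>Q. l q) = k"
      using packs_split[of Q ?E k t] E assms(1) by force
    then show "k \<le> (\<Sum>q\<in>Q. packing_number (?E q) t)"
      by (auto simp: packs_iff intro: sum_mono)
  next
    assume k: "k \<le> (\<Sum>q\<in>Q. packing_number (?E q) t)"
    have "packs (\<Union>q\<in>Q. ?E q) (\<Sum>q\<in>Q. packing_number (?E q) t) t"
      by (rule packs_sum[OF assms(1) _ sub]) (simp add: packs_iff)
    then show "packs E k t" using k packs_antimono unfolding E[symmetric] by blast
  qed
qed

section \<open>Weighted vertex covers and inert vertices of bipartite graphs\<close>

definition crossing :: "'v set \<Rightarrow> ('v \<times> 'v) set \<Rightarrow> bool" where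
  "crossing A E \<longleftrightarrow> (\<forall>(a, b)\<in>E. a \<in> A \<longleftrightarrow> b \<notin> A)"

text \<open>Koenig's theorem for the graph in which each vertex \<open>v\<close> is replaced by \<open>t v\<close> copies.\<close>

lemma bipartite_min_cover:
  fixes E :: "('v::finite \<times> 'v) set"
  assumes "crossing A E" "sym E"
  shows "\<exists>C. (\<forall>(a, b)\<in>E. a \<in> C \<or> b \<in> C) \<and> (\<Sum>v\<in>C. t v) \<le> packing_number E t"
proof -
  \<comment> \<open>\<open>E\<close> contains both orientations of an edge; \<open>D\<close> keeps
    the one that leaves \<open>A\<close>, so that Koenig's theorem sees two separate sides.\<close>
  define D where "D = {(a, b) \<in> E. a \<in> A}"
  have D: "(a, b) \<in> E \<and> a \<in> A \<and> b \<notin> A" if "(a, b) \<in> D" for a b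
    using that assms by (fastforce simp: D_def crossing_def)
  define F where "F = {((a, i), (b, j)) | a i b j. (a, b) \<in> D \<and> i < t a \<and> j < t b}"
  have "F \<subseteq> (SIGMA a:UNIV. {..<t a}) \<times> (SIGMA b:UNIV. {..<t b})"
    by (auto simp: F_def)
  then have "finite F" by (rule finite_subset) auto
  then obtain M X Y where M: "M \<subseteq> F" "inj_on fst M" "inj_on snd M"
    and XY: "edge_cover F X Y" "card X + card Y \<le> card M"
    using koenig by metis
  have fin: "finite X" "finite Y" "finite M"
    using XY M \<open>finite F\<close> by (auto simp: edge_cover_def intro: finite_subset)
  \<comment> \<open>A vertex enters \<open>C\<close> only if all of its copies are covered. An edge
    missed by \<open>C\<close> would have an uncovered copy at each end, and these copies are joined
    in \<open>F\<close>. A vertex with \<open>t v = 0\<close> enters at no cost.\<close>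
  define C where "C = {a \<in> A. \<forall>i<t a. (a, i) \<in> X} \<union> {b. b \<notin> A \<and> (\<forall>j<t b. (b, j) \<in> Y)}"
  have cover: "a \<in> C \<or> b \<in> C" if ab: "(a, b) \<in> D" for a b
  proof (rule ccontr)
    assume "\<not> ?thesis"
    then obtain i j where "i < t a" "j < t b" "(a, i) \<notin> X" "(b, j) \<notin> Y"
      using D[OF ab] by (auto simp: C_def)
    moreover from this have "((a, i), (b, j)) \<in> F" using ab by (auto simp: F_def)
    ultimately show False using XY(1) by (auto simp: edge_cover_def)
  qed
  have "a \<in> C \<or> b \<in> C" if "(a, b) \<in> E" for a b
    using that cover[of a b] cover[of b a] assms
    by (auto simp: D_def crossing_def dest: symD)
  moreover have "(\<Sum>v\<in>C. t v) \<le> packing_number E t"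
  proof -
    have sig: "card (SIGMA v:S. {..<t v}) = (\<Sum>v\<in>S. t v)" for S :: "'v set"
      by (subst card_SigmaI) auto
    have "(\<Sum>v\<in>C. t v) = (\<Sum>v\<in>C \<inter> A. t v) + (\<Sum>v\<in>C - A. t v)"
      by (metis add.commute finite sum.Int_Diff)
    also have "\<dots> \<le> card X + card Y"
      unfolding sig[symmetric] by (intro add_mono card_mono fin) (auto simp: C_def)
    also have "\<dots> \<le> card M" by (rule XY)
    also have "packs E (card M) t"
    proof -
      define pr where "pr z = (fst (fst z), fst (snd z))" for z :: "('v \<times> nat) \<times> ('v \<times> nat)"
      have pr: "pr z \<in> E \<and> snd (fst z) < t (fst (fst z)) \<and> snd (snd z) < t (fst (snd z)) \<and>
          fst (fst z) \<in> A \<and> fst (snd z) \<notin> A" if z: "z \<in> M" for z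
      proof -
        obtain a i b j where "z = ((a, i), (b, j))" "(a, b) \<in> D" "i < t a" "j < t b"
          using z M(1) unfolding F_def by blast
        with D show ?thesis by (auto simp: pr_def)
      qed
      have "mult_deg (image_mset pr (mset_set M)) v \<le> t v" for v
      proof -
        have "mult_deg (image_mset pr (mset_set M)) v =
            card {z \<in> M. fst (fst z) = v} + card {z \<in> M. fst (snd z) = v}"
          by (simp add: mult_deg_def image_mset.compositionality o_def pr_def count_image_mset_set fin)
        also have "\<dots> \<le> t v"
        \<comment> \<open>All pairs lead from \<open>A\<close> to its complement, so one of the two
          counts vanishes; the other is bounded because the matching uses each copy at most
          once.\<close>
        proof (cases "v \<in> A")
          case True
          then have "fst (snd z) \<noteq> v" if "z \<in> M" for z using pr[OF that] by metis
          then have "card {z \<in> M. fst (snd z) = v} = 0" by (metis (mono_tags, lifting) card.empty Collect_empty_eq)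
          moreover have "card {z \<in> M. fst (fst z) = v} \<le> t v"
            by (rule card_fst_fibre_le[OF M(2)]) (use pr in blast)
          ultimately show ?thesis by simp
        next
          case False
          then have "fst (fst z) \<noteq> v" if "z \<in> M" for z using pr[OF that] by metis
          then have "card {z \<in> M. fst (fst z) = v} = 0" by (metis (mono_tags, lifting) card.empty Collect_empty_eq)
          moreover have "card {z \<in> M. fst (snd z) = v} \<le> t v"
            by (rule card_fst_fibre_le[OF M(3)]) (use pr in blast)
          ultimately show ?thesis by simp
        qed
        finally show ?thesis .
      qed
      then have "packs E (size (image_mset pr (mset_set M))) t"
        using pr fin by (intro packsI) auto
      then show ?thesis by simp
    qed
    then have "card M \<le> packing_number E t" by (simp add: packs_iff)
    finally show ?thesis .
  qed
  ultimately show ?thesis by blast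
qed

text \<open>Raising an entry outside a cover does not change the weight of the cover, and for a
  minimum cover this weight is at most the old packing number. The case left is a minimum cover that
  contains all of \<open>B\<close>.\<close>

lemma bipartite_inert_vertex:
  fixes E :: "('v::finite \<times> 'v) set"
  assumes "crossing A E" "sym E" "E \<subseteq> B \<times> B" "B \<noteq> {}"
  shows "\<exists>v\<in>B. \<forall>m. packing_number E (t(v := m)) \<le> packing_number E t"
proof -
  have inert: "packing_number E (t(v := m)) \<le> packing_number E t"
    if C: "\<forall>(a, b)\<in>E. a \<in> C \<or> b \<in> C" "(\<Sum>v\<in>C. t v) \<le> packing_number E t" "v \<notin> C" for C v m
  proof -
    have "packing_number E (t(v := m)) \<le> (\<Sum>w\<in>C. (t(v := m)) w)"
      by (rule packs_le_sum_cover[OF _ C(1) packs_iff[THEN iffD2, OF order_refl]]) simp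
    also have "\<dots> = (\<Sum>w\<in>C. t w)" using C(3) by (intro sum.cong) auto
    finally show ?thesis using C(2) by simp
  qed
  obtain C where C: "\<forall>(a, b)\<in>E. a \<in> C \<or> b \<in> C" "(\<Sum>v\<in>C. t v) \<le> packing_number E t"
    using bipartite_min_cover[OF assms(1,2), of t] by blast
  show ?thesis
  proof (cases "B \<subseteq> C")
    case False
    then show ?thesis using inert[OF C] by blast
  next
    case True
    obtain M where M: "set_mset M \<subseteq> E" "size M = packing_number E t" "\<And>v. mult_deg M v \<le> t v"
      by (metis order_refl packs_iff packsE)
    \<comment> \<open>The weight on \<open>B\<close> is at least twice the packing number but at
      most the weight of \<open>C\<close>, hence at most the packing number itself. So all entries
      on \<open>B\<close> vanish.\<close>
    have "2 * packing_number E t = (\<Sum>v\<in>B. mult_deg M v)"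
      using sum_mult_deg[of B M] M assms(3) by auto
    also have "\<dots> \<le> (\<Sum>v\<in>B. t v)" using M by (intro sum_mono) auto
    also have "\<dots> \<le> (\<Sum>v\<in>C. t v)" using True by (intro sum_mono2) auto
    finally have 0: "(\<Sum>v\<in>B. t v) = 0"
      using C(2) \<open>(\<Sum>v\<in>B. t v) \<le> (\<Sum>v\<in>C. t v)\<close> by linarith
    show ?thesis
    proof (cases "E = {}")
      case True
      then show ?thesis using inert[of "{}"] assms(4) by auto
    next
      case False
      then obtain v where v: "v \<in> B" "v \<notin> A"
        using assms(1,3) by (fastforce simp: crossing_def)
      \<comment> \<open>With zero weights on \<open>B\<close>, the colour class
        \<open>A \<inter> B\<close> is a minimum cover too, and it misses \<open>v\<close>.\<close>
      have "\<forall>(a, b)\<in>E. a \<in> A \<inter> B \<or> b \<in> A \<inter> B" using assms(1,3) by (fastforce simp: crossing_def)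
      moreover have "(\<Sum>v\<in>A \<inter> B. t v) \<le> packing_number E t"
        using 0 by simp
      ultimately show ?thesis using inert[of "A \<inter> B" v] v by auto
    qed
  qed
qed

section \<open>Partitions into cones\<close>

text \<open>
  In the coordinates from \<open>B\<close>, the cones with apex \<open>apex t\<close> spanned by the directions in \<open>dirs t\<close>
  form a partition of \<open>D\<close>, and \<open>t\<close> lies in the cone with index \<open>t\<close>.
\<close>

definition conical_on ::
    "'v set \<Rightarrow> nat \<Rightarrow> ('v \<Rightarrow> nat) set \<Rightarrow> (('v \<Rightarrow> nat) \<Rightarrow> 'v \<Rightarrow> nat) \<Rightarrow> (('v \<Rightarrow> nat) \<Rightarrow> 'v set) \<Rightarrow> bool" where
  "conical_on B g D apex dirs \<longleftrightarrow>
     (\<forall>t\<in>D. dirs t \<noteq> {} \<and> dirs t \<subseteq> B \<and> (\<forall>v\<in>B. apex t v \<le> t v \<and> apex t v \<le> g) \<and>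
       (\<forall>v\<in>B - dirs t. apex t v = t v) \<and>
       (\<forall>s. (\<forall>v\<in>B. apex t v \<le> s v) \<longrightarrow> (\<forall>v\<in>B - dirs t. s v = apex t v) \<longrightarrow>
          s \<in> D \<and> dirs s = dirs t \<and> (\<forall>v\<in>B. apex s v = apex t v)))"

text \<open>These are the properties of a truncated packing number that the construction uses. By
  \<open>mono\<close> only the coordinates in \<open>B\<close> matter, by \<open>clamp\<close> all
  entries from \<open>g\<close> on are interchangeable, and \<open>inert\<close> together with
  \<open>mono\<close> gives a ray inside the level set.\<close>

locale level_set =
  fixes B :: "'v::finite set" and \<sigma> :: "('v \<Rightarrow> nat) \<Rightarrow> nat" and g i :: nat
  assumes mono: "\<And>s t. (\<And>v. v \<in> B \<Longrightarrow> s v \<le> t v) \<Longrightarrow> \<sigma> s \<le> \<sigma> t"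
    and clamp: "\<And>t. \<sigma> t \<le> \<sigma> (\<lambda>v. min (t v) g)"
    and inert: "\<And>t. \<sigma> t = i \<Longrightarrow> \<exists>v\<in>B. \<forall>m. \<sigma> (t(v := m)) \<le> i"
begin

text \<open>All values \<open>m\<close> are tested, not only those above \<open>t v\<close>, so
  membership of \<open>v\<close> does not depend on the entry \<open>t v\<close>.\<close>

definition inerts :: "('v \<Rightarrow> nat) \<Rightarrow> 'v set" where
  "inerts t = {v \<in> B. \<forall>m. \<sigma> (t(v := m)) \<le> i}"

text \<open>
  Taking the least inert vertex keeps the choice stable: \<open>inerts\<close> is antitone, so along an inert
  direction that is chosen once it remains the least one.
\<close>

definition chosen :: "('v \<Rightarrow> nat) \<Rightarrow> 'v" where
  "chosen t = arg_min (to_nat :: 'v \<Rightarrow> nat) (\<lambda>v. v \<in> inerts t)"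

definition high :: "('v \<Rightarrow> nat) \<Rightarrow> 'v set" where
  "high t = {v \<in> B. g \<le> t v}"

text \<open>Entries that have reached \<open>g\<close> may vary freely from \<open>g\<close> on. If
  there are none, a single inert direction is followed; once its entry reaches \<open>g\<close> it
  is the only high coordinate, so both cases agree along the ray.\<close>

definition dirs :: "('v \<Rightarrow> nat) \<Rightarrow> 'v set" where
  "dirs t = (if high t = {} then {chosen t} else high t)"

text \<open>The apex goes back as far as level and directions permit. With several high coordinates
  it stops at \<open>g\<close>; with a single direction it may start lower, among the points without
  high entries.\<close>

definition apex :: "('v \<Rightarrow> nat) \<Rightarrow> 'v \<Rightarrow> nat" where
  "apex t v = (if v \<in> dirs t then LEAST m. \<sigma> (t(v := m)) = i \<and> dirs (t(v := m)) = dirs t else t v)"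

section \<open>Invariance of level and directions along a cone\<close>

lemma \<sigma>_cong: "(\<And>v. v \<in> B \<Longrightarrow> s v = t v) \<Longrightarrow> \<sigma> s = \<sigma> t"
  by (simp add: mono order_antisym)

text \<open>Truncated at \<open>g\<close> the two vectors agree on \<open>B\<close>, so
  \<open>clamp\<close> followed by \<open>mono\<close> compares them both ways.\<close>

lemma \<sigma>_high:
  assumes "\<And>v. v \<in> B \<Longrightarrow> s v = t v \<or> g \<le> s v \<and> g \<le> t v"
  shows "\<sigma> s = \<sigma> t"
proof -
  have "\<sigma> s' \<le> \<sigma> t'" if "\<And>v. v \<in> B \<Longrightarrow> s' v = t' v \<or> g \<le> s' v \<and> g \<le> t' v" for s' t'
  proof -
    have "\<sigma> s' \<le> \<sigma> (\<lambda>v. min (s' v) g)" by (rule clamp)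
    also have "\<dots> \<le> \<sigma> t'" by (rule mono) (use that in fastforce)
    finally show ?thesis .
  qed
  from this[of s t] this[of t s] show ?thesis using assms by (metis order_antisym)
qed

lemma high_cong: "(\<And>v. v \<in> B \<Longrightarrow> s v = t v) \<Longrightarrow> high s = high t"
  by (auto simp: high_def)

lemma inerts_antimono:
  assumes "\<And>v. v \<in> B \<Longrightarrow> s v \<le> t v"
  shows "inerts t \<subseteq> inerts s"
proof -
  have "\<sigma> (s(v := m)) \<le> \<sigma> (t(v := m))" for v m
    by (rule mono) (simp add: assms)
  then show ?thesis unfolding inerts_def by (blast intro: order_trans)
qed

lemma inerts_cong: "(\<And>v. v \<in> B \<Longrightarrow> s v = t v) \<Longrightarrow> inerts s = inerts t"
  by (simp add: inerts_antimono subset_antisym)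

lemma dirs_cong:
  assumes "\<And>v. v \<in> B \<Longrightarrow> s v = t v"
  shows "dirs s = dirs t"
  using high_cong[OF assms] inerts_cong[OF assms] by (simp add: dirs_def chosen_def)

lemma chosen_in: "\<sigma> t = i \<Longrightarrow> chosen t \<in> inerts t"
proof -
  assume "\<sigma> t = i"
  then obtain v where "v \<in> inerts t" using inert unfolding inerts_def by blast
  then show ?thesis unfolding chosen_def by (rule arg_min_natI)
qed

text \<open>The minimum of a set is also the minimum of every subset containing it, and
  \<open>to_nat\<close> is injective.\<close>

lemma chosen_eqI: "chosen t \<in> inerts s \<Longrightarrow> inerts s \<subseteq> inerts t \<Longrightarrow> chosen s = chosen t"
proof -
  assume a: "chosen t \<in> inerts s" "inerts s \<subseteq> inerts t"
  have s: "chosen s \<in> inerts s" unfolding chosen_def by (rule arg_min_natI) (rule a)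
  have "to_nat (chosen s) \<le> to_nat (chosen t)"
    unfolding chosen_def[of s] by (rule arg_min_nat_le) (rule a)
  moreover have "to_nat (chosen t) \<le> to_nat (chosen s)"
    unfolding chosen_def[of t] by (rule arg_min_nat_le) (use a s in blast)
  ultimately show ?thesis by simp
qed

lemma dirs_subset: "\<sigma> t = i \<Longrightarrow> dirs t \<subseteq> B"
  using chosen_in[of t] by (auto simp: dirs_def high_def inerts_def)

lemma dirs_nonempty: "dirs t \<noteq> {}"
  by (simp add: dirs_def)

text \<open>If \<open>w\<close> was chosen as inert, inertness bounds the level from above and
  monotonicity from below. Below \<open>g\<close> the inert set only shrinks and keeps
  \<open>w\<close>, so \<open>w\<close> remains its least element; from \<open>g\<close> on
  \<open>w\<close> is the only high coordinate. If \<open>w\<close> was high already, larger entries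
  are interchangeable.\<close>

lemma single_dir_upward:
  assumes t: "\<sigma> t = i" "dirs t = {w}" "t w \<le> m"
  shows "\<sigma> (t(w := m)) = i \<and> dirs (t(w := m)) = {w}"
proof (cases "high t = {}")
  case True
  then have w: "w = chosen t" using t(2) by (simp add: dirs_def)
  with chosen_in[OF t(1)] have wi: "w \<in> inerts t" by simp
  have le: "t v \<le> (t(w := m)) v" for v using t(3) by simp
  have "\<sigma> t \<le> \<sigma> (t(w := m))" by (rule mono) (rule le)
  with wi t(1) have \<sigma>: "\<sigma> (t(w := m)) = i" by (auto simp: inerts_def intro: order_antisym)
  have "dirs (t(w := m)) = {w}"
  proof (cases "g \<le> m")
    case True
    then have "high (t(w := m)) = {w}"
      using \<open>high t = {}\<close> wi by (auto simp: high_def inerts_def)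
    then show ?thesis by (simp add: dirs_def)
  next
    case False
    then have "high (t(w := m)) = {}"
      using \<open>high t = {}\<close> by (auto simp: high_def)
    moreover have "w \<in> inerts (t(w := m))" using wi by (simp add: inerts_def)
    then have "chosen (t(w := m)) = w"
      unfolding w by (intro chosen_eqI inerts_antimono) (use w le in auto)
    ultimately show ?thesis by (simp add: dirs_def)
  qed
  with \<sigma> show ?thesis by simp
next
  case False
  then have h: "high t = {w}" using t(2) by (simp add: dirs_def split: if_splits)
  then have "g \<le> t w" by (auto simp: high_def)
  then have "high (t(w := m)) = high t" using t(3) by (auto simp: high_def)
  moreover have "\<sigma> (t(w := m)) = \<sigma> t"
    by (rule \<sigma>_high) (use \<open>g \<le> t w\<close> t(3) in auto)
  ultimately show ?thesis using h t(1) by (simp add: dirs_def)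
qed

text \<open>Lowering a high entry to exactly \<open>g\<close> changes neither level nor directions.
  If another coordinate is high, lowering it further removes \<open>w\<close> from the
  directions.\<close>

lemma apex_high:
  assumes t: "\<sigma> t = i" and w: "w \<in> dirs t" "g \<le> t w"
  shows "apex t w \<le> g" "dirs t \<noteq> {w} \<Longrightarrow> apex t w = g"
proof -
  have hw: "high t \<noteq> {}" using w dirs_subset[OF t] by (auto simp: high_def)
  then have h: "dirs t = high t" by (simp add: dirs_def)
  let ?P = "\<lambda>m. \<sigma> (t(w := m)) = i \<and> dirs (t(w := m)) = dirs t"
  have a: "apex t w = (LEAST m. ?P m)" using w by (simp add: apex_def)
  have "high (t(w := g)) = high t" using w by (auto simp: high_def)
  then have "dirs (t(w := g)) = dirs t" using hw by (simp add: dirs_def)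
  moreover have "\<sigma> (t(w := g)) = \<sigma> t"
    by (rule \<sigma>_high) (use w in auto)
  ultimately have P: "?P g" using t by simp
  then show "apex t w \<le> g" unfolding a by (rule Least_le)
  assume ne: "dirs t \<noteq> {w}"
  have "g \<le> m" if "?P m" for m
  proof (rule ccontr)
    assume "\<not> g \<le> m"
    then have "high (t(w := m)) = high t - {w}" by (auto simp: high_def)
    moreover have "high t - {w} \<noteq> {}" using h ne w by auto
    ultimately have "dirs (t(w := m)) = high t - {w}" by (simp add: dirs_def)
    then show False using that h w by auto
  qed
  then show "apex t w = g" unfolding a using P by (intro Least_equality)
qed

lemma apex_le:
  assumes t: "\<sigma> t = i"
  shows "apex t v \<le> t v"
  unfolding apex_def by (auto intro!: Least_le simp: t)

lemma apex_le_bound: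
  assumes t: "\<sigma> t = i" "v \<in> B"
  shows "apex t v \<le> g"
proof (cases "g \<le> t v")
  case True
  then have "v \<in> dirs t" using t(2) by (auto simp: dirs_def high_def)
  then show ?thesis using apex_high(1)[OF t(1) _ True] by simp
next
  case False
  then show ?thesis using apex_le[OF t(1), of v] by simp
qed

text \<open>A cone with one direction is a ray, which \<open>single_dir_upward\<close> keeps in the
  level set with the same direction. With several directions all of them are high with apex
  \<open>g\<close>, so \<open>s\<close> and \<open>t\<close> have the same high coordinates.\<close>

lemma cone_closed:
  assumes t: "\<sigma> t = i" and ge: "\<And>v. v \<in> B \<Longrightarrow> apex t v \<le> s v"
    and eq: "\<And>v. v \<in> B - dirs t \<Longrightarrow> s v = apex t v"
  shows "\<sigma> s = i" "dirs s = dirs t" "v \<in> B \<Longrightarrow> apex s v = apex t v"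
proof -
  have eq': "s v = t v" if "v \<in> B" "v \<notin> dirs t" for v
    using eq[of v] that by (simp add: apex_def)
  have "\<sigma> s = i \<and> dirs s = dirs t \<and> (\<forall>v\<in>B. apex s v = apex t v)"
  proof (cases "\<exists>w. dirs t = {w}")
    case True
    then obtain w where w: "dirs t = {w}" by blast
    then have wB: "w \<in> B" using dirs_subset[OF t] by simp
    let ?P = "\<lambda>u m. \<sigma> (u(w := m)) = i \<and> dirs (u(w := m)) = {w}"
    have a: "apex t w = (LEAST m. ?P t m)" using w by (simp add: apex_def)
    have "?P t (apex t w)"
      unfolding a by (rule LeastI[of _ "t w"]) (simp add: t w)
    then have P: "?P t (s w)"
      using single_dir_upward[of "t(w := apex t w)" w "s w"] ge[OF wB] by simp
    have st: "s v = (t(w := s w)) v" if "v \<in> B" for v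
      using eq' w that by auto
    have \<sigma>: "\<sigma> s = i" and d: "dirs s = {w}"
      using P by (simp_all only: \<sigma>_cong[OF st] dirs_cong[OF st])
    \<comment> \<open>\<open>?P\<close> overwrites the entry at \<open>w\<close>, the only one in
      \<open>B\<close> where \<open>s\<close> and \<open>t\<close> may differ, so the least values
      agree.\<close>
    have "?P s m = ?P t m" for m
      using \<sigma>_cong[of "s(w := m)" "t(w := m)"] dirs_cong[of "s(w := m)" "t(w := m)"] eq' w by simp
    then have "apex s w = apex t w" unfolding a using d by (simp add: apex_def)
    then have "\<forall>v\<in>B. apex s v = apex t v"
      using d w eq' by (auto simp: apex_def)
    then show ?thesis using \<sigma> d w by simp
  next
    case False
    then have h: "high t = dirs t" by (auto simp: dirs_def split: if_splits)
    have g: "apex t w = g" "g \<le> t w" "g \<le> s w" if "w \<in> dirs t" for w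
    proof -
      show "g \<le> t w" using that h by (auto simp: high_def)
      with that show "apex t w = g" using apex_high(2)[OF t] False by blast
      then show "g \<le> s w" using ge[of w] that dirs_subset[OF t] by auto
    qed
    have "\<sigma> s = \<sigma> t"
      by (rule \<sigma>_high) (use g eq' in blast)
    then have \<sigma>: "\<sigma> s = i" using t by simp
    have "high s = high t"
      using g(2,3) eq' dirs_subset[OF t] h by (fastforce simp: high_def)
    moreover have "high t \<noteq> {}" using h dirs_nonempty[of t] by metis
    ultimately have d: "dirs s = dirs t" unfolding dirs_def by simp
    have "apex s v = apex t v" if "v \<in> B" for v
    proof (cases "v \<in> dirs t")
      case True
      then show ?thesis using apex_high(2)[OF \<sigma>, of v] g[of v] d False by auto
    next
      case False
      then show ?thesis using d eq' that by (simp add: apex_def)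
    qed
    then show ?thesis using \<sigma> d by simp
  qed
  then show "\<sigma> s = i" "dirs s = dirs t" "v \<in> B \<Longrightarrow> apex s v = apex t v" by auto
qed

theorem conical_level_set: "conical_on B g {t. \<sigma> t = i} apex dirs"
  unfolding conical_on_def
proof (intro ballI conjI allI impI)
  fix t v assume "t \<in> {t. \<sigma> t = i}"
  then have t: "\<sigma> t = i" by simp
  show "dirs t \<noteq> {}" "dirs t \<subseteq> B" using dirs_nonempty dirs_subset t by auto
  show "apex t v \<le> t v" "v \<in> B \<Longrightarrow> apex t v \<le> g" using apex_le apex_le_bound t by auto
  show "v \<in> B - dirs t \<Longrightarrow> apex t v = t v" by (simp add: apex_def)
  fix s assume s: "\<forall>v\<in>B. apex t v \<le> s v" "\<forall>v\<in>B - dirs t. s v = apex t v"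
  show "s \<in> {t. \<sigma> t = i}" "dirs s = dirs t" "v \<in> B \<Longrightarrow> apex s v = apex t v"
    using cone_closed[OF t, of s] s by auto
qed

end

text \<open>For \<open>i = j\<close> the level set says that the packing number is at least
  \<open>j\<close>, and every vertex is inert because the truncated value cannot exceed
  \<open>j\<close>. For smaller \<open>i\<close> it fixes the packing number, and
  \<open>bipartite_inert_vertex\<close> applies.\<close>

lemma conical_packing_level:
  fixes E :: "('v::finite \<times> 'v) set"
  assumes E: "E \<subseteq> B \<times> B" "B \<noteq> {}" "sym E" and g: "2 * j \<le> g"
    and inert: "i = j \<or> (\<exists>A. crossing A E)"
  shows "\<exists>apex dirs. conical_on B g {t. min (packing_number E t) j = i} apex dirs"
proof -
  have "level_set B (\<lambda>t. min (packing_number E t) j) g i"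
  proof
    fix s t :: "'v \<Rightarrow> nat" assume le: "\<And>v. v \<in> B \<Longrightarrow> s v \<le> t v"
    have "packs E (packing_number E s) s" by (simp add: packs_iff)
    then have "packs E (packing_number E s) t" by (rule packs_mono_on[OF _ E(1) le])
    then show "min (packing_number E s) j \<le> min (packing_number E t) j"
      by (auto simp: packs_iff min_def)
  next
    fix t :: "'v \<Rightarrow> nat"
    have "packs E (min (packing_number E t) j) t" by (simp add: packs_iff)
    then have "packs E (min (packing_number E t) j) (\<lambda>v. min (t v) g)"
      by (rule packs_clamp) (use g in auto)
    then show "min (packing_number E t) j \<le> min (packing_number E (\<lambda>v. min (t v) g)) j"
      by (simp add: packs_iff)
  next
    fix t :: "'v \<Rightarrow> nat" assume t: "min (packing_number E t) j = i"
    show "\<exists>v\<in>B. \<forall>m. min (packing_number E (t(v := m))) j \<le> i"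
    proof (cases "i = j")
      case True
      then show ?thesis using E(2) by auto
    next
      case False
      then obtain v where v: "v \<in> B" "\<And>m. packing_number E (t(v := m)) \<le> packing_number E t"
        using inert bipartite_inert_vertex[OF _ E(3,1,2)] by blast
      have "min (packing_number E (t(v := m))) j \<le> i" for m
        using v(2)[of m] t by (auto simp: min_def split: if_splits)
      with v(1) show ?thesis by blast
    qed
  qed
  then show ?thesis using level_set.conical_level_set by blast
qed

text \<open>For fixed levels the condition is a product over the blocks, and a product of cones is a
  cone with the united directions. The levels are constant on each such cone, so the products form
  one partition.\<close>

lemma conical_packs:
  fixes E :: "('v::finite \<times> 'v) set" and blk :: "'v \<Rightarrow> 'b"
  assumes E: "sym E" "\<And>a b. (a, b) \<in> E \<Longrightarrow> blk a = blk b"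
    and blk: "range blk = insert r Q" "r \<notin> Q" "finite Q"
    and bip: "\<And>q. q \<in> Q \<Longrightarrow> \<exists>A. crossing A {e \<in> E. blk (fst e) = q}"
  shows "\<exists>apex dirs. conical_on UNIV (2 * k) {t. packs E k t} apex dirs \<and>
    (\<forall>t. packs E k t \<longrightarrow> card Q + 1 \<le> card (dirs t))"
proof -
  define B where "B q = blk -` {q}" for q
  define e where "e q t = packing_number {e \<in> E. blk (fst e) = q} t" for q t
  \<comment> \<open>On block \<open>r\<close>, truncation at \<open>i\<close> itself turns the level
    set into \<open>i \<le> e r t\<close>; on a block in \<open>Q\<close>, truncation at
    \<open>k\<close> makes it fix \<open>min (e q t) k\<close>.\<close>
  define bd where "bd q i = (if q = r then i else k)" for q i
  define D where "D q i = {t. min (e q t) (bd q i) = i}" for q i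
  have "\<exists>apex dirs. conical_on (B q) (2 * k) (D q i) apex dirs"
    if "q \<in> insert r Q" "i \<le> k" for q i
    unfolding D_def e_def
  proof (rule conical_packing_level)
    show "{e \<in> E. blk (fst e) = q} \<subseteq> B q \<times> B q" using E(2) by (auto simp: B_def)
    show "B q \<noteq> {}" using that blk(1) unfolding B_def by (metis imageE singletonI vimageI2 empty_iff)
    show "sym {e \<in> E. blk (fst e) = q}"
      using E by (intro symI) (fastforce dest: symD)
    show "2 * bd q i \<le> 2 * k" using that by (simp add: bd_def)
    show "i = bd q i \<or> (\<exists>A. crossing A {e \<in> E. blk (fst e) = q})"
      using that bip by (auto simp: bd_def)
  qed
  then obtain ap di where con: "\<And>q i. q \<in> insert r Q \<Longrightarrow> i \<le> k \<Longrightarrow>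
      conical_on (B q) (2 * k) (D q i) (ap q i) (di q i)"
    by metis
  define lo where "lo t = (\<Sum>q\<in>Q. min (e q t) k)" for t
  \<comment> \<open>For \<open>r\<close> this is what remains to be supplied, namely 0 if the blocks
    in \<open>Q\<close> already supply \<open>k\<close>.\<close>
  define lev where "lev t q = (if q = r then k - lo t else min (e q t) k)" for t q
  have lev_le: "lev t q \<le> k" for t q by (simp add: lev_def)
  have packs: "packs E k t \<longleftrightarrow> (\<forall>q\<in>insert r Q. t \<in> D q (lev t q))" for t
  proof -
    have "packs E k t \<longleftrightarrow> k \<le> e r t + (\<Sum>q\<in>Q. e q t)"
      using packs_blocks_iff[of "insert r Q" blk E k t] blk E(2) by (auto simp: e_def)
    also have "\<dots> \<longleftrightarrow> k \<le> e r t + lo t"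
    \<comment> \<open>If one block alone reaches \<open>k\<close>, both inequalities hold; otherwise
      truncation at \<open>k\<close> changes nothing.\<close>
    proof (cases "\<exists>q\<in>Q. k \<le> e q t")
      case True
      then obtain q where q: "q \<in> Q" "k \<le> e q t" by blast
      have "min (e q t) k \<le> lo t" unfolding lo_def using q blk(3) by (intro member_le_sum) auto
      moreover have "e q t \<le> (\<Sum>q\<in>Q. e q t)" using q blk(3) by (intro member_le_sum) auto
      ultimately show ?thesis using q by auto
    next
      case False
      then have "lo t = (\<Sum>q\<in>Q. e q t)" unfolding lo_def by (intro sum.cong) auto
      then show ?thesis by simp
    qed
    also have "\<dots> \<longleftrightarrow> t \<in> D r (lev t r)" by (auto simp: D_def bd_def lev_def)
    \<comment> \<open>On the blocks in \<open>Q\<close> membership holds by the choice of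
      \<open>lev\<close>.\<close>
    also have "\<dots> \<longleftrightarrow> (\<forall>q\<in>insert r Q. t \<in> D q (lev t q))"
      using blk(2) by (auto simp: D_def bd_def lev_def)
    finally show ?thesis .
  qed
  define apex where "apex t v = ap (blk v) (lev t (blk v)) t v" for t v
  define dirs where "dirs t = (\<Union>q\<in>insert r Q. di q (lev t q) t)" for t
  have blk_in: "blk v \<in> insert r Q" for v using blk(1) by auto
  have B: "v \<in> B q \<longleftrightarrow> blk v = q" for v q by (auto simp: B_def)
  let ?a = "\<lambda>q t. ap q (lev t q) t" and ?d = "\<lambda>q t. di q (lev t q) t"
  have apex: "apex t v = ?a q t v" if "v \<in> B q" for t v q
    using that by (simp add: apex_def B)
  have main: "?d q t \<noteq> {} \<and> ?d q t \<subseteq> B q \<and>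
      (\<forall>v\<in>B q. ?a q t v \<le> t v \<and> ?a q t v \<le> 2 * k) \<and> (\<forall>v\<in>B q - ?d q t. ?a q t v = t v) \<and>
      (\<forall>s. (\<forall>v\<in>B q. ?a q t v \<le> s v) \<longrightarrow> (\<forall>v\<in>B q - ?d q t. s v = ?a q t v) \<longrightarrow>
          s \<in> D q (lev t q) \<and> di q (lev t q) s = ?d q t \<and>
          (\<forall>v\<in>B q. ap q (lev t q) s v = ?a q t v))"
    if "packs E k t" "q \<in> insert r Q" for t q
  proof -
    have "t \<in> D q (lev t q)" using that packs by blast
    then show ?thesis
      by (rule bspec[OF con[OF that(2) lev_le[of t q], unfolded conical_on_def]])
  qed
  have ne: "?d q t \<noteq> {}" and sub: "\<And>v. v \<in> ?d q t \<Longrightarrow> blk v = q"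
    if "packs E k t" "q \<in> insert r Q" for t q
    using main[OF that] B by blast+
  have in_dirs: "v \<in> dirs t \<longleftrightarrow> v \<in> ?d (blk v) t" if "packs E k t" for t v
    using sub[OF that] blk_in[of v] unfolding dirs_def by blast
  have "conical_on UNIV (2 * k) {t. packs E k t} apex dirs"
    unfolding conical_on_def
  proof (intro ballI conjI allI impI)
    fix t v assume "t \<in> {t. packs E k t}"
    then have t: "packs E k t" by simp
    show "dirs t \<noteq> {}" using ne[OF t, of r] by (simp add: dirs_def)
    show "dirs t \<subseteq> UNIV" by simp
    have v: "v \<in> B (blk v)" by (simp add: B)
    show "apex t v \<le> t v" "apex t v \<le> 2 * k"
      unfolding apex[OF v] using main[OF t blk_in[of v]] v by blast+
    show "apex t v = t v" if "v \<in> UNIV - dirs t"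
      unfolding apex[OF v] using main[OF t blk_in[of v]] in_dirs[OF t] that v by blast
    fix s assume s: "\<forall>v\<in>UNIV. apex t v \<le> s v" "\<forall>v\<in>UNIV - dirs t. s v = apex t v"
    have s': "s \<in> D q (lev t q)" "di q (lev t q) s = ?d q t"
      "\<And>v. v \<in> B q \<Longrightarrow> ap q (lev t q) s v = apex t v" if q: "q \<in> insert r Q" for q
    proof -
      have "\<forall>v\<in>B q. ?a q t v \<le> s v"
        using s(1) apex[of _ q t] by (metis UNIV_I)
      moreover have "\<forall>v\<in>B q - ?d q t. s v = ?a q t v"
      proof
        fix v assume v: "v \<in> B q - ?d q t"
        then have "v \<notin> dirs t" using in_dirs[OF t] by (simp add: B)
        then show "s v = ?a q t v" using s(2) apex[of v q t] v by simp
      qed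
      ultimately have *: "s \<in> D q (lev t q) \<and> di q (lev t q) s = ?d q t \<and>
          (\<forall>v\<in>B q. ap q (lev t q) s v = ?a q t v)"
        using main[OF t q] by blast
      then show "s \<in> D q (lev t q)" "di q (lev t q) s = ?d q t" by blast+
      show "ap q (lev t q) s v = apex t v" if "v \<in> B q" for v
        using * that apex[OF that, of t] by metis
    qed
    \<comment> \<open>Membership in the level sets of \<open>t\<close> fixes the truncated values on
      \<open>Q\<close>, hence \<open>lo\<close> and the demand on \<open>r\<close>, so
      \<open>s\<close> has the levels of \<open>t\<close>.\<close>
    have "min (e q s) k = min (e q t) k" if "q \<in> Q" for q
      using s'[of q] that blk(2) by (auto simp: D_def bd_def lev_def split: if_splits)
    then have "lo s = lo t" "\<And>q. q \<in> insert r Q \<Longrightarrow> lev s q = lev t q"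
      unfolding lo_def lev_def by auto
    then have lev: "lev s q = lev t q" if "q \<in> insert r Q" for q using that by blast
    show "s \<in> {t. packs E k t}" using s' lev by (simp add: packs)
    show "dirs s = dirs t" unfolding dirs_def using s' lev by auto
    show "apex s v = apex t v" using s'[OF blk_in[of v]] lev[OF blk_in[of v]] apex[OF v, of s] v by metis
  qed
  moreover have "card Q + 1 \<le> card (dirs t)" if t: "packs E k t" for t
  proof -
    \<comment> \<open>The blocks are disjoint and each contains a direction, so it suffices to count
      labels.\<close>
    have "insert r Q \<subseteq> blk ` dirs t"
    proof
      fix q assume q: "q \<in> insert r Q"
      then obtain v where "v \<in> di q (lev t q) t" "blk v = q" using ne[OF t q] sub[OF t q] by blast
      then show "q \<in> blk ` dirs t" using q unfolding dirs_def by blast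
    qed
    then have "card (insert r Q) \<le> card (blk ` dirs t)" by (intro card_mono) auto
    also have "\<dots> \<le> card (dirs t)" by (rule card_image_le) simp
    finally show ?thesis using blk by simp
  qed
  ultimately show ?thesis by blast
qed

section \<open>Monomial spans and Stanley decompositions\<close>

definition monomial_span :: "('v \<Rightarrow>\<^sub>0 nat) set \<Rightarrow> ('v, 'k::zero) mpoly set" where
  "monomial_span T = {p. Poly_Mapping.keys p \<subseteq> T}"

lemma sum_monomials:
  "(\<Sum>t\<in>Poly_Mapping.keys p. Poly_Mapping.single t (Poly_Mapping.lookup p t)) = p"
  for p :: "'a \<Rightarrow>\<^sub>0 'b::comm_monoid_add"
  by (rule poly_mapping_eqI)
    (auto simp: lookup_sum lookup_single when_def sum.delta' in_keys_iff)

lemma single_in_monomial_span: "t \<in> T \<Longrightarrow> Poly_Mapping.single t c \<in> monomial_span T"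
  by (simp add: monomial_span_def)

lemma lookup_eq_0_of_monomial_span: "p \<in> monomial_span T \<Longrightarrow> t \<notin> T \<Longrightarrow> Poly_Mapping.lookup p t = 0"
  unfolding monomial_span_def mem_Collect_eq using in_keys_iff[of t p] by blast

lemma add_in_monomial_span:
  "p \<in> monomial_span T \<Longrightarrow> q \<in> monomial_span T \<Longrightarrow> p + q \<in> monomial_span T"
  using Poly_Mapping.keys_add[of p q] unfolding monomial_span_def by auto

lemma sum_in_monomial_span:
  assumes "\<And>i. i \<in> I \<Longrightarrow> f i \<in> monomial_span T"
  shows "sum f I \<in> monomial_span T"
  using assms
proof (induction I rule: infinite_finite_induct)
  case (insert i I)
  then show ?case by (simp add: add_in_monomial_span)
qed (simp_all add: monomial_span_def)

lemma mult_in_monomial_span: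
  assumes "p \<in> monomial_span S" "q \<in> monomial_span T"
    "\<And>s t. s \<in> S \<Longrightarrow> t \<in> T \<Longrightarrow> s + t \<in> U"
  shows "p * q \<in> monomial_span U"
  using keys_mult[of p q] assms unfolding monomial_span_def by fast

lemma subspace_monomial_span:
  assumes "\<And>s t. t \<in> T \<Longrightarrow> s + t \<in> T"
  shows "module.subspace (*) (monomial_span T :: ('v, 'k::comm_ring_1) mpoly set)"
proof -
  interpret module "(*) :: ('v, 'k) mpoly \<Rightarrow> _" by (rule module_times)
  show ?thesis
  proof (rule subspaceI)
    show "c * p \<in> monomial_span T" if "p \<in> monomial_span T" for c p :: "('v, 'k) mpoly"
      by (rule mult_in_monomial_span[of _ UNIV _ T])
        (use that assms in \<open>auto simp: monomial_span_def\<close>)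
  qed (simp_all add: add_in_monomial_span, simp add: monomial_span_def)
qed

lemma in_ideal_generatedI:
  fixes X :: "('v, 'k::comm_ring_1) mpoly set"
  assumes "\<And>t. t \<in> Poly_Mapping.keys p \<Longrightarrow> \<exists>q\<in>X. q dvd Poly_Mapping.single t (Poly_Mapping.lookup p t)"
  shows "p \<in> ideal_generated X"
proof -
  interpret module "(*) :: ('v, 'k) mpoly \<Rightarrow> _" by (rule module_times)
  have "(\<Sum>t\<in>Poly_Mapping.keys p. Poly_Mapping.single t (Poly_Mapping.lookup p t)) \<in> span X"
  proof (rule span_sum)
    fix t assume "t \<in> Poly_Mapping.keys p"
    then obtain q c where "q \<in> X" "Poly_Mapping.single t (Poly_Mapping.lookup p t) = q * c"
      using assms unfolding dvd_def by blast
    then show "Poly_Mapping.single t (Poly_Mapping.lookup p t) \<in> span X"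
      using span_scale[OF span_base, of q X c] by (simp add: mult.commute)
  qed
  then show ?thesis unfolding sum_monomials ideal_generated_def .
qed

lemma ideal_generated_monomials:
  "ideal_generated ((\<lambda>t. Poly_Mapping.single t 1) ` T) =
    (monomial_span {s + t | s t. t \<in> T} :: ('v, 'k::comm_ring_1) mpoly set)"
    (is "ideal_generated ?X = ?M")
proof
  interpret module "(*) :: ('v, 'k) mpoly \<Rightarrow> _" by (rule module_times)
  have "subspace ?M"
    by (rule subspace_monomial_span) (auto, metis add.assoc)
  moreover have "?X \<subseteq> ?M" by (auto intro!: single_in_monomial_span, metis add_0)
  ultimately show "ideal_generated ?X \<subseteq> ?M" unfolding ideal_generated_def by (intro span_minimal)
next
  show "?M \<subseteq> ideal_generated ?X"
  proof (rule subsetI, rule in_ideal_generatedI)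
    fix p :: "('v, 'k) mpoly" and u assume "p \<in> ?M" "u \<in> Poly_Mapping.keys p"
    then obtain s t where u: "u = s + t" "t \<in> T" by (auto simp: monomial_span_def)
    then have "Poly_Mapping.single u (Poly_Mapping.lookup p u) =
        Poly_Mapping.single t 1 * Poly_Mapping.single s (Poly_Mapping.lookup p u)"
      by (simp add: mult_single add.commute)
    then show "\<exists>q\<in>?X. q dvd Poly_Mapping.single u (Poly_Mapping.lookup p u)"
      using u(2) by (metis dvd_triv_left imageI)
  qed
qed

text \<open>Closure of \<open>S\<close> under shifts makes the right side an ideal; conversely each
  of its terms is itself a product of one element from either factor.\<close>

lemma ideal_mult_monomial_span:
  assumes "\<And>s t. t \<in> S \<Longrightarrow> s + t \<in> S"
  shows "ideal_mult (monomial_span S) (monomial_span T) =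
    (monomial_span {s + t | s t. s \<in> S \<and> t \<in> T} :: ('v, 'k::comm_ring_1) mpoly set)"
    (is "ideal_mult ?S ?T = ?M")
proof
  interpret module "(*) :: ('v, 'k) mpoly \<Rightarrow> _" by (rule module_times)
  have "subspace ?M"
    by (rule subspace_monomial_span) (use assms in \<open>auto, metis add.assoc\<close>)
  moreover have "{p * q | p q. p \<in> ?S \<and> q \<in> ?T} \<subseteq> ?M"
    by (auto intro!: mult_in_monomial_span[of _ S _ T])
  ultimately show "ideal_mult ?S ?T \<subseteq> ?M"
    unfolding ideal_mult_def ideal_generated_def by (intro span_minimal)
next
  show "?M \<subseteq> ideal_mult ?S ?T"
    unfolding ideal_mult_def
  proof (rule subsetI, rule in_ideal_generatedI)
    fix p :: "('v, 'k) mpoly" and u assume "p \<in> ?M" "u \<in> Poly_Mapping.keys p"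
    then obtain s t where u: "u = s + t" "s \<in> S" "t \<in> T" by (auto simp: monomial_span_def)
    then have "Poly_Mapping.single u (Poly_Mapping.lookup p u) =
        Poly_Mapping.single s (Poly_Mapping.lookup p u) * Poly_Mapping.single t 1"
      by (simp add: mult_single)
    also have "\<dots> \<in> {p * q | p q. p \<in> ?S \<and> q \<in> ?T}"
      using u single_in_monomial_span by blast
    finally show "\<exists>q\<in>{p * q | p q. p \<in> ?S \<and> q \<in> ?T}.
        q dvd Poly_Mapping.single u (Poly_Mapping.lookup p u)"
      by (rule bexI[where x = "Poly_Mapping.single u (Poly_Mapping.lookup p u)", rotated]) simp
  qed
qed

text \<open>This translates the ideal into packings: multiplying by \<open>edge_ideal G\<close> adds
  one edge to the exponent, which is \<open>packs_Suc_iff\<close>.\<close>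

lemma edge_ideal_power:
  fixes G :: "('v::finite, 'e) pre_digraph"
  shows "ideal_power (edge_ideal G) k =
    (monomial_span {t. packs (arcs_ends G) k (Poly_Mapping.lookup t)} :: ('v, 'k::comm_ring_1) mpoly set)"
proof (induction k)
  case 0
  then show ?case by (simp add: monomial_span_def)
next
  case (Suc k)
  define W where "W = {Poly_Mapping.single v (1::nat) + Poly_Mapping.single w 1 | v w. v \<rightarrow>\<^bsub>G\<^esub> w}"
  have "{Var v * Var w | v w. v \<rightarrow>\<^bsub>G\<^esub> w} = (\<lambda>t. Poly_Mapping.single t (1::'k)) ` W"
    unfolding W_def Var_def image_Collect by (auto simp: mult_single)
  then have I: "edge_ideal G = (monomial_span {s + t | s t. t \<in> W} :: ('v, 'k) mpoly set)"
    unfolding edge_ideal_def by (simp only: ideal_generated_monomials)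
  have "ideal_power (edge_ideal G) (Suc k) = ideal_mult (edge_ideal G)
    (monomial_span {t. packs (arcs_ends G) k (Poly_Mapping.lookup t)} :: ('v, 'k) mpoly set)"
    by (simp only: ideal_power.simps Suc.IH)
  also have "\<dots> = (monomial_span {s + t | s t. s \<in> {s + t | s t. t \<in> W} \<and> packs (arcs_ends G) k (Poly_Mapping.lookup t)} :: ('v, 'k) mpoly set)"
    unfolding I by (subst ideal_mult_monomial_span) (auto, metis add.assoc)
  also have "{s + t | s t. s \<in> {s + t | s t. t \<in> W} \<and> packs (arcs_ends G) k (Poly_Mapping.lookup t)} =
      {t. packs (arcs_ends G) (Suc k) (Poly_Mapping.lookup t)}"
  proof (intro equalityI subsetI)
    fix u assume "u \<in> {s + t | s t. s \<in> {s + t | s t. t \<in> W} \<and> packs (arcs_ends G) k (Poly_Mapping.lookup t)}"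
    then obtain s v w t where u: "u = s + (Poly_Mapping.single v 1 + Poly_Mapping.single w 1) + t"
      "v \<rightarrow>\<^bsub>G\<^esub> w" "packs (arcs_ends G) k (Poly_Mapping.lookup t)"
      unfolding W_def by blast
    have "packs (arcs_ends G) k (Poly_Mapping.lookup (s + t))"
      by (rule packs_mono_on[OF u(3), of UNIV]) (auto simp: lookup_add)
    moreover have "Poly_Mapping.lookup u x =
        Poly_Mapping.lookup (s + t) x + of_bool (v = x) + of_bool (w = x)" for x
      by (simp add: u(1) lookup_add lookup_single when_def)
    ultimately show "u \<in> {t. packs (arcs_ends G) (Suc k) (Poly_Mapping.lookup t)}"
      using u(2) unfolding mem_Collect_eq packs_Suc_iff by blast
  next
    fix u assume "u \<in> {t. packs (arcs_ends G) (Suc k) (Poly_Mapping.lookup t)}"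
    then obtain v w s where s: "(v, w) \<in> arcs_ends G" "packs (arcs_ends G) k s"
      "\<And>x. Poly_Mapping.lookup u x = s x + of_bool (v = x) + of_bool (w = x)"
      unfolding mem_Collect_eq packs_Suc_iff by blast
    \<comment> \<open>Every function is finitely supported because the variables form a finite
      type.\<close>
    have l: "Poly_Mapping.lookup (Abs_poly_mapping s) = s" by simp
    \<comment> \<open>The summand 0 is the trivial shift that exhibits the edge itself as an
      exponent in the edge ideal.\<close>
    have u: "u = (0 + (Poly_Mapping.single v 1 + Poly_Mapping.single w 1)) + Abs_poly_mapping s"
      by (rule poly_mapping_eqI) (simp add: s(3) lookup_add lookup_single when_def)
    show "u \<in> {s + t | s t. s \<in> {s + t | s t. t \<in> W} \<and> packs (arcs_ends G) k (Poly_Mapping.lookup t)}"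
    proof -
      have "Poly_Mapping.single v 1 + Poly_Mapping.single w 1 \<in> W" using s(1) unfolding W_def by blast
      moreover have "packs (arcs_ends G) k (Poly_Mapping.lookup (Abs_poly_mapping s))"
        unfolding l by (rule s(2))
      ultimately show ?thesis using u by blast
    qed
  qed
  finally show ?case .
qed

section \<open>Stanley decompositions from partitions into cones\<close>

lemma lookup_mult_single_add:
  "Poly_Mapping.lookup (p * Poly_Mapping.single b 1) (s + b) = Poly_Mapping.lookup p s"
  for p :: "('v, 'k::comm_ring_1) mpoly"
proof -
  have "p * Poly_Mapping.single b 1 =
      (\<Sum>t\<in>Poly_Mapping.keys p. Poly_Mapping.single (t + b) (Poly_Mapping.lookup p t))"
    by (subst (1) sum_monomials[symmetric]) (simp add: sum_distrib_right mult_single)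
  then show ?thesis
    by (auto simp: lookup_sum lookup_single when_def sum.delta' in_keys_iff)
qed

definition cone :: "('v \<Rightarrow>\<^sub>0 nat) \<Rightarrow> 'v set \<Rightarrow> ('v \<Rightarrow>\<^sub>0 nat) set" where
  "cone b Z = {t. (\<forall>v. Poly_Mapping.lookup b v \<le> Poly_Mapping.lookup t v) \<and>
    (\<forall>v. v \<notin> Z \<longrightarrow> Poly_Mapping.lookup t v = Poly_Mapping.lookup b v)}"

lemma cone_altdef: "cone b Z = {s + b | s. Poly_Mapping.keys s \<subseteq> Z}"
proof (intro equalityI subsetI)
  fix t assume t: "t \<in> cone b Z"
  have "t = (t - b) + b"
    by (rule poly_mapping_eqI) (use t in \<open>simp add: lookup_add lookup_minus cone_def\<close>)
  moreover have "Poly_Mapping.keys (t - b) \<subseteq> Z"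
    using t by (auto simp: in_keys_iff lookup_minus cone_def)
  ultimately show "t \<in> {s + b | s. Poly_Mapping.keys s \<subseteq> Z}" by blast
qed (auto simp: cone_def lookup_add in_keys_iff)

lemma cyclic_span_monomial:
  "cyclic_span (*) (Poly_Mapping.single b 1) Z = (monomial_span (cone b Z) :: ('v, 'k::comm_ring_1) mpoly set)"
proof (intro equalityI subsetI)
  fix q :: "('v, 'k) mpoly" assume "q \<in> cyclic_span (*) (Poly_Mapping.single b 1) Z"
  then obtain p where p: "p \<in> monomial_span {s. Poly_Mapping.keys s \<subseteq> Z}" "q = p * Poly_Mapping.single b 1"
    by (auto simp: cyclic_span_def poly_subring_def monomial_span_def)
  show "q \<in> monomial_span (cone b Z)"
    unfolding p(2) by (rule mult_in_monomial_span[OF p(1) single_in_monomial_span[of b "{b}"]])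
      (auto simp: cone_altdef)
next
  fix q :: "('v, 'k) mpoly" assume q: "q \<in> monomial_span (cone b Z)"
  \<comment> \<open>\<open>p\<close> is the quotient of \<open>q\<close> by the monomial with
    exponent \<open>b\<close>; exponents in the cone dominate \<open>b\<close>, so the division is
    exact.\<close>
  define p where "p = (\<Sum>t\<in>Poly_Mapping.keys q. Poly_Mapping.single (t - b) (Poly_Mapping.lookup q t))"
  have t: "t - b + b = t \<and> Poly_Mapping.keys (t - b) \<subseteq> Z" if "t \<in> Poly_Mapping.keys q" for t
  proof -
    have "t \<in> cone b Z" using q that by (auto simp: monomial_span_def)
    then obtain s where "t = s + b" "Poly_Mapping.keys s \<subseteq> Z" unfolding cone_altdef by blast
    then show ?thesis by simp
  qed
  have "p * Poly_Mapping.single b 1 = (\<Sum>t\<in>Poly_Mapping.keys q. Poly_Mapping.single t (Poly_Mapping.lookup q t))"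
    unfolding p_def sum_distrib_right by (rule sum.cong) (use t in \<open>auto simp: mult_single\<close>)
  then have "q = p * Poly_Mapping.single b 1" by (simp add: sum_monomials)
  moreover have "p \<in> monomial_span {s. Poly_Mapping.keys s \<subseteq> Z}"
    unfolding p_def by (intro sum_in_monomial_span single_in_monomial_span) (use t in auto)
  ultimately show "q \<in> cyclic_span (*) (Poly_Mapping.single b 1) Z"
    by (auto simp: cyclic_span_def poly_subring_def monomial_span_def)
qed

lemma stanley_space_monomial:
  assumes "b \<in> T"
  shows "stanley_space (*) degree_component (monomial_span T)
    (Poly_Mapping.single b 1 :: ('v, 'k::comm_ring_1) mpoly) Z"
  unfolding stanley_space_def
proof (intro conjI ballI impI)
  show "Poly_Mapping.single b 1 \<in> monomial_span T" using assms by (rule single_in_monomial_span)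
  show "\<exists>a. (Poly_Mapping.single b 1 :: ('v, 'k) mpoly) \<in> degree_component a"
    by (rule exI[of _ "\<lambda>x. int (Poly_Mapping.lookup b x)"]) (simp add: degree_component_def)
  fix p :: "('v, 'k) mpoly" assume "p * Poly_Mapping.single b 1 = 0"
  then show "p = 0"
    using lookup_mult_single_add[of p b] by (intro poly_mapping_eqI) simp
qed

text \<open>The coefficient of a sum at \<open>t\<close> comes only from the summand whose
  \<open>K d\<close> contains \<open>t\<close>. So the summands can be read off from the sum, and
  any polynomial is cut into them along the partition.\<close>

lemma bij_betw_direct_sum:
  fixes K :: "'d \<Rightarrow> ('v \<Rightarrow>\<^sub>0 nat) set"
  assumes fin: "finite D" and sub: "\<And>d. d \<in> D \<Longrightarrow> K d \<subseteq> T"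
    and part: "\<And>t. t \<in> T \<Longrightarrow> \<exists>!d. d \<in> D \<and> t \<in> K d"
  shows "bij_betw (\<lambda>f. \<Sum>d\<in>D. f d) (\<Pi>\<^sub>E d\<in>D. monomial_span (K d))
    (monomial_span T :: ('v, 'k::comm_monoid_add) mpoly set)"
proof -
  have lookup: "Poly_Mapping.lookup (\<Sum>d\<in>D. f d) t = Poly_Mapping.lookup (f d) t"
    if f: "\<And>d. d \<in> D \<Longrightarrow> f d \<in> (monomial_span (K d) :: ('v, 'k) mpoly set)" and d: "d \<in> D" "t \<in> K d" for f d t
  proof -
    have "Poly_Mapping.lookup (f d') t = 0" if "d' \<in> D - {d}" for d'
    proof -
      have "t \<notin> K d'" using part[of t] sub[OF d(1)] d that by blast
      then show ?thesis using lookup_eq_0_of_monomial_span[OF f[of d']] that by simp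
    qed
    then have "(\<Sum>d'\<in>D. Poly_Mapping.lookup (f d') t) = (\<Sum>d'\<in>{d}. Poly_Mapping.lookup (f d') t)"
      using fin d by (intro sum.mono_neutral_right) auto
    then show ?thesis by (simp add: lookup_sum)
  qed
  show ?thesis
  proof (rule bij_betwI')
    fix f g :: "'d \<Rightarrow> ('v, 'k) mpoly"
    assume f: "f \<in> (\<Pi>\<^sub>E d\<in>D. monomial_span (K d))" and g: "g \<in> (\<Pi>\<^sub>E d\<in>D. monomial_span (K d))"
    show "(\<Sum>d\<in>D. f d) = (\<Sum>d\<in>D. g d) \<longleftrightarrow> f = g"
    proof
      assume eq: "(\<Sum>d\<in>D. f d) = (\<Sum>d\<in>D. g d)"
      show "f = g"
      proof (rule PiE_ext[OF f g])
        fix d assume d: "d \<in> D"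
        show "f d = g d"
        proof (rule poly_mapping_eqI)
          fix t
          show "Poly_Mapping.lookup (f d) t = Poly_Mapping.lookup (g d) t"
          proof (cases "t \<in> K d")
            case True
            then show ?thesis using lookup[of f d t] lookup[of g d t] f g d eq by (auto simp: PiE_iff)
          next
            case False
            have "f d \<in> monomial_span (K d)" "g d \<in> monomial_span (K d)" using f g d by auto
            then show ?thesis using lookup_eq_0_of_monomial_span False by metis
          qed
        qed
      qed
    qed simp
  next
    fix f :: "'d \<Rightarrow> ('v, 'k) mpoly"
    assume f: "f \<in> (\<Pi>\<^sub>E d\<in>D. monomial_span (K d))"
    show "(\<Sum>d\<in>D. f d) \<in> monomial_span T"
    proof (rule sum_in_monomial_span)
      fix d assume d: "d \<in> D"
      then have "f d \<in> monomial_span (K d)" using f by auto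
      with sub[OF d] show "f d \<in> monomial_span T" by (auto simp: monomial_span_def)
    qed
  next
    fix p :: "('v, 'k) mpoly" assume p: "p \<in> monomial_span T"
    define h where "h d = (\<Sum>t\<in>Poly_Mapping.keys p \<inter> K d. Poly_Mapping.single t (Poly_Mapping.lookup p t))" for d
    have h: "h d \<in> monomial_span (K d)" for d
      unfolding h_def by (intro sum_in_monomial_span single_in_monomial_span) auto
    have h_lookup: "Poly_Mapping.lookup (h d) t = Poly_Mapping.lookup p t" if "t \<in> K d" for d t
      using that by (auto simp: h_def lookup_sum lookup_single when_def sum.delta' in_keys_iff)
    have "p = (\<Sum>d\<in>D. h d)"
    proof (rule poly_mapping_eqI)
      fix t
      show "Poly_Mapping.lookup p t = Poly_Mapping.lookup (\<Sum>d\<in>D. h d) t"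
      proof (cases "t \<in> T")
        case True
        then obtain d where "d \<in> D" "t \<in> K d" using part by blast
        then show ?thesis using lookup[of h d t] h h_lookup by simp
      next
        case False
        have "(\<Sum>d\<in>D. h d) \<in> monomial_span T"
          using h sub by (intro sum_in_monomial_span) (auto simp: monomial_span_def)
        then show ?thesis using lookup_eq_0_of_monomial_span[OF _ False] p by metis
      qed
    qed
    \<comment> \<open>Members of the extensional product are \<open>undefined\<close> outside
      \<open>D\<close>, hence the restriction.\<close>
    also have "\<dots> = (\<Sum>d\<in>D. restrict h D d)" by simp
    finally show "\<exists>f\<in>(\<Pi>\<^sub>E d\<in>D. monomial_span (K d)). p = (\<Sum>d\<in>D. f d)"
      using h by (intro bexI[of _ "restrict h D"]) auto
  qed
qed

lemma stanley_decomposition_cones: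
  assumes fin: "finite C" and sub: "\<And>b Z. (b, Z) \<in> C \<Longrightarrow> cone b Z \<subseteq> T"
    and part: "\<And>t. t \<in> T \<Longrightarrow> \<exists>!c. c \<in> C \<and> t \<in> cone (fst c) (snd c)"
  shows "stanley_decomposition (*) degree_component
    (monomial_span T :: ('v, 'k::comm_ring_1) mpoly set) ((\<lambda>(b, Z). (Poly_Mapping.single b 1, Z)) ` C)"
    (is "stanley_decomposition _ _ _ (?m ` C)")
proof -
  \<comment> \<open>The exponent \<open>b\<close> is recovered as the only key, so every pair in the
    image comes from one cone, which \<open>K\<close> reads off.\<close>
  have inj: "inj ?m" by (auto simp: inj_on_def dest: arg_cong[of _ _ Poly_Mapping.keys])
  define K where "K d = (\<lambda>c. cone (fst c) (snd c)) (inv ?m d)" for d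
  have K: "K (?m c) = cone (fst c) (snd c)" for c unfolding K_def using inj by simp
  have span: "(case d of (u, Z) \<Rightarrow> cyclic_span (*) u Z) = (monomial_span (K d) :: ('v, 'k) mpoly set)"
    if d: "d \<in> ?m ` C" for d
    using d K by (auto simp: cyclic_span_monomial)
  have "bij_betw (\<lambda>f. \<Sum>d\<in>?m ` C. f d) (\<Pi>\<^sub>E d\<in>?m ` C. monomial_span (K d))
      (monomial_span T :: ('v, 'k) mpoly set)"
  proof (rule bij_betw_direct_sum)
    show "finite (?m ` C)" using fin by simp
    show "K d \<subseteq> T" if d: "d \<in> ?m ` C" for d
    proof -
      obtain c where "c \<in> C" "d = ?m c" using d by blast
      then show ?thesis using K[of c] sub[of "fst c" "snd c"] by simp
    qed
    fix t assume "t \<in> T"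
    then obtain c where c: "c \<in> C" "t \<in> cone (fst c) (snd c)"
      "\<And>c'. c' \<in> C \<Longrightarrow> t \<in> cone (fst c') (snd c') \<Longrightarrow> c' = c" using part by metis
    show "\<exists>!d. d \<in> ?m ` C \<and> t \<in> K d"
    proof (rule ex1I[of _ "?m c"])
      show "?m c \<in> ?m ` C \<and> t \<in> K (?m c)" using c K by blast
      fix d assume "d \<in> ?m ` C \<and> t \<in> K d"
      then obtain c' where "d = ?m c'" "c' \<in> C" "t \<in> K (?m c')" by blast
      then show "d = ?m c" using c(3) K by metis
    qed
  qed
  moreover have "(\<Pi>\<^sub>E d\<in>?m ` C. monomial_span (K d)) =
      (\<Pi>\<^sub>E (u, Z)\<in>?m ` C. (cyclic_span (*) u Z :: ('v, 'k) mpoly set))"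
    by (rule PiE_cong) (use span in metis)
  moreover have "b \<in> T" if bZ: "(b, Z) \<in> C" for b Z
    using sub[OF bZ] by (auto simp: cone_def)
  ultimately show ?thesis
    using fin unfolding stanley_decomposition_def by (auto intro!: stanley_space_monomial)
qed

lemma sdepth_geI:
  fixes M :: "'m::comm_monoid_add set" and D :: "('m \<times> 'v::finite set) set"
  assumes D: "stanley_decomposition scale gr M D" "D \<noteq> {}" "\<And>u Z. (u, Z) \<in> D \<Longrightarrow> d \<le> card Z"
  shows "d \<le> sdepth scale gr M"
proof -
  let ?S = "{sdepth_decomposition D | D. stanley_decomposition scale gr M D}"
  have fin: "finite D" if "stanley_decomposition scale gr M D" for D
    using that by (simp add: stanley_decomposition_def)
  \<comment> \<open>An empty decomposition has the unspecified value \<open>Min {}\<close>; as a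
    single extra value it does not affect finiteness.\<close>
  have "?S \<subseteq> insert (sdepth_decomposition ({} :: ('m \<times> 'v set) set)) {..card (UNIV :: 'v set)}"
  proof
    fix n assume "n \<in> ?S"
    then obtain D' where D': "stanley_decomposition scale gr M D'" "n = sdepth_decomposition D'" by blast
    show "n \<in> insert (sdepth_decomposition ({} :: ('m \<times> 'v set) set)) {..card (UNIV :: 'v set)}"
    proof (cases "D' = {}")
      case False
      then have "n \<in> (\<lambda>(u, Z). card Z) ` D'"
        unfolding D'(2) sdepth_decomposition_def using fin[OF D'(1)] by (intro Min_in) auto
      then show ?thesis by (auto intro: card_mono)
    qed (use D' in simp)
  qed
  then have "finite ?S" by (rule finite_subset) simp
  moreover have "sdepth_decomposition D \<in> ?S" using D(1) by blast
  ultimately have "sdepth_decomposition D \<le> sdepth scale gr M"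
    unfolding sdepth_def by (rule Max_ge)
  moreover have "d \<le> sdepth_decomposition D"
    unfolding sdepth_decomposition_def using fin[OF D(1)] D(2,3) by (intro Min.boundedI) auto
  ultimately show ?thesis by simp
qed

text \<open>Cones are indexed by apex and directions. All points of a cone share this index, so the
  cones are disjoint, and there are finitely many because every apex is bounded by
  \<open>g\<close>.\<close>

lemma sdepth_ge_of_conical:
  fixes T :: "('v::finite \<Rightarrow> nat) set"
  assumes con: "conical_on UNIV g T apex dirs" and card: "\<And>t. t \<in> T \<Longrightarrow> d \<le> card (dirs t)"
    and ne: "T \<noteq> {}"
  shows "d \<le> sdepth (*) degree_component
    (monomial_span {t. Poly_Mapping.lookup t \<in> T} :: ('v, 'k::comm_ring_1) mpoly set)"
proof -
  let ?T = "{t. Poly_Mapping.lookup t \<in> T}"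
  define \<phi> where "\<phi> t = (Abs_poly_mapping (apex (Poly_Mapping.lookup t)), dirs (Poly_Mapping.lookup t))" for t
  have lookup_Abs: "Poly_Mapping.lookup (Abs_poly_mapping f) = f" for f :: "'v \<Rightarrow> nat" by simp
  have cone: "s \<in> cone (fst (\<phi> t)) (snd (\<phi> t)) \<longleftrightarrow> (\<forall>v. apex (Poly_Mapping.lookup t) v \<le> Poly_Mapping.lookup s v) \<and>
      (\<forall>v. v \<notin> dirs (Poly_Mapping.lookup t) \<longrightarrow> Poly_Mapping.lookup s v = apex (Poly_Mapping.lookup t) v)" for s t
    by (simp add: \<phi>_def cone_def lookup_Abs)
  have self: "t \<in> cone (fst (\<phi> t)) (snd (\<phi> t))" if "t \<in> ?T" for t
    unfolding cone using con that unfolding conical_on_def by (metis Diff_iff UNIV_I mem_Collect_eq)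
  have closed: "s \<in> ?T \<and> \<phi> s = \<phi> t" if t: "t \<in> ?T" and s: "s \<in> cone (fst (\<phi> t)) (snd (\<phi> t))" for s t
  proof -
    have "Poly_Mapping.lookup s \<in> T \<and> dirs (Poly_Mapping.lookup s) = dirs (Poly_Mapping.lookup t) \<and>
        (\<forall>v\<in>UNIV. apex (Poly_Mapping.lookup s) v = apex (Poly_Mapping.lookup t) v)"
      using con t s unfolding cone conical_on_def by blast
    then show ?thesis unfolding \<phi>_def by (metis UNIV_I ext mem_Collect_eq)
  qed
  have "\<phi> ` ?T \<subseteq> (Abs_poly_mapping ` (\<Pi>\<^sub>E v\<in>UNIV. {..g})) \<times> UNIV"
  proof
    fix c assume "c \<in> \<phi> ` ?T"
    then obtain t where t: "c = \<phi> t" "Poly_Mapping.lookup t \<in> T" by blast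
    have "apex (Poly_Mapping.lookup t) v \<le> g" for v
      using con t(2) unfolding conical_on_def by blast
    then have "apex (Poly_Mapping.lookup t) \<in> (\<Pi>\<^sub>E v\<in>UNIV. {..g})"
      by (simp add: PiE_iff)
    then show "c \<in> (Abs_poly_mapping ` (\<Pi>\<^sub>E v\<in>UNIV. {..g})) \<times> UNIV"
      unfolding t(1) \<phi>_def by blast
  qed
  then have "finite (\<phi> ` ?T)"
    by (rule finite_subset) (intro finite_SigmaI finite_imageI finite_PiE, auto)
  then have "stanley_decomposition (*) degree_component (monomial_span ?T :: ('v, 'k) mpoly set)
      ((\<lambda>(b, Z). (Poly_Mapping.single b 1, Z)) ` \<phi> ` ?T)"
  proof (rule stanley_decomposition_cones)
    fix b Z assume "(b, Z) \<in> \<phi> ` ?T"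
    then obtain t where t: "(b, Z) = \<phi> t" "t \<in> ?T" by (rule imageE)
    then have "cone b Z = cone (fst (\<phi> t)) (snd (\<phi> t))" by (metis fst_conv snd_conv)
    then show "cone b Z \<subseteq> ?T" using closed[OF t(2)] by blast
  next
    fix t assume t: "t \<in> ?T"
    show "\<exists>!c. c \<in> \<phi> ` ?T \<and> t \<in> cone (fst c) (snd c)"
    proof (rule ex1I[of _ "\<phi> t"])
      show "\<phi> t \<in> \<phi> ` ?T \<and> t \<in> cone (fst (\<phi> t)) (snd (\<phi> t))" using t self by blast
      fix c assume c: "c \<in> \<phi> ` ?T \<and> t \<in> cone (fst c) (snd c)"
      then obtain t' where t': "c = \<phi> t'" "t' \<in> ?T" by (elim conjE imageE)
      then have "\<phi> t = \<phi> t'" using c by (intro conjunct2[OF closed]) simp_all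
      then show "c = \<phi> t" using t'(1) by simp
    qed
  qed
  then show ?thesis
  proof (rule sdepth_geI)
    obtain t where "t \<in> T" using ne by blast
    then have "Abs_poly_mapping t \<in> ?T" unfolding mem_Collect_eq lookup_Abs .
    then show "(\<lambda>(b, Z). (Poly_Mapping.single b (1::'k), Z)) ` \<phi> ` ?T \<noteq> {}" by blast
    show "d \<le> card Z" if "(u, Z) \<in> (\<lambda>(b, Z). (Poly_Mapping.single b (1::'k), Z)) ` \<phi> ` ?T" for u Z
      using that card by (auto simp: \<phi>_def)
  qed
qed

section \<open>Components\<close>

lemma nonbipartite_has_arc:
  assumes "\<not> bipartite G"
  obtains e where "e \<in> arcs G"
  using assms unfolding bipartite_def by blast

lemma (in wf_digraph) scc_of_eq_iff: "v \<in> verts G \<Longrightarrow> scc_of u = scc_of v \<longleftrightarrow> v \<in> scc_of u"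
  using in_scc_of_self[of v] unfolding scc_of_def by (blast intro: reachable_trans)

lemma (in sym_digraph) scc_of_arc:
  assumes "e \<in> arcs G"
  shows "scc_of (tail G e) = scc_of (head G e)"
proof -
  have "tail G e \<rightarrow> head G e" using assms by (auto simp: arcs_ends_conv)
  then have "tail G e \<rightarrow>\<^sup>* head G e" by (rule reachable_adjI)
  then have "head G e \<in> scc_of (tail G e)"
    using symmetric_reachable' by (auto simp: scc_of_def)
  then show ?thesis using scc_of_eq_iff assms by auto
qed

text \<open>Bipartitions of the components are glued. Contraposed, this provides a non-bipartite
  component.\<close>

lemma (in sym_digraph) bipartite_of_sccs:
  assumes "\<And>v. v \<in> verts G \<Longrightarrow> bipartite (G \<restriction> scc_of v)"
  shows "bipartite G"
proof -
  let ?parts = "\<lambda>S A B. S = A \<union> B \<and> A \<inter> B = {} \<and>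
    (\<forall>e\<in>arcs (G \<restriction> S). (tail G e \<in> A \<and> head G e \<in> B) \<or> (tail G e \<in> B \<and> head G e \<in> A))"
  have "\<exists>A B. ?parts (scc_of v) A B" if "v \<in> verts G" for v
    using assms[OF that] by (simp add: bipartite_def)
  then obtain A B where AB: "\<And>v. v \<in> verts G \<Longrightarrow> ?parts (scc_of v) (A v) (B v)"
    by metis
  \<comment> \<open>\<open>A\<close> and \<open>B\<close> depend on the vertex, and two vertices of
    one component may have received opposite colourings. Passing to a representative makes the
    choice depend on the component only.\<close>
  define f where "f S = (SOME v. v \<in> verts G \<and> scc_of v = S)" for S
  have f: "f (scc_of v) \<in> verts G \<and> scc_of (f (scc_of v)) = scc_of v" if "v \<in> verts G" for v
    unfolding f_def by (rule someI[of _ v]) (use that in simp)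
  define A' where "A' S = A (f S)" for S
  define B' where "B' S = B (f S)" for S
  have parts: "?parts (scc_of v) (A' (scc_of v)) (B' (scc_of v))" if "v \<in> verts G" for v
    using AB[of "f (scc_of v)"] f[OF that] unfolding A'_def B'_def by simp
  let ?A = "{v \<in> verts G. v \<in> A' (scc_of v)}" and ?B = "{v \<in> verts G. v \<in> B' (scc_of v)}"
  have "verts G = ?A \<union> ?B"
    using parts in_scc_of_self by blast
  moreover have "?A \<inter> ?B = {}" using parts by blast
  moreover have "(tail G e \<in> ?A \<and> head G e \<in> ?B) \<or> (tail G e \<in> ?B \<and> head G e \<in> ?A)"
    if e: "e \<in> arcs G" for e
  proof -
    let ?S = "scc_of (tail G e)"
    have S: "scc_of (head G e) = ?S" using scc_of_arc[OF e] by simp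
    have v: "tail G e \<in> verts G" "head G e \<in> verts G" using e by auto
    then have "e \<in> arcs (G \<restriction> ?S)"
      using e in_scc_of_self[OF v(1)] in_scc_of_self[OF v(2)] S by simp
    then show ?thesis using parts[OF v(1)] v S by simp
  qed
  ultimately show ?thesis unfolding bipartite_def by blast
qed

theorem corollary3p2:
  fixes G :: "('v::finite, 'e) pre_digraph" and p k :: nat
  assumes "graph G"
    and "verts G = UNIV"
    and "\<not> bipartite G"
    and "p = card {H \<in> pre_digraph.sccs G. bipartite H}"
    and "k \<ge> 1"
  shows "sdepth (*) degree_component
           (ideal_power (edge_ideal G :: ('v, 'k::field) mpoly set) k) \<ge> p + 1"
proof -
  interpret graph G by (rule assms(1))
  let ?bip = "\<lambda>v. bipartite (G \<restriction> scc_of v)"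
  define Q where "Q = scc_of ` {v. ?bip v}"
  \<comment> \<open>The label \<open>{}\<close> stands for the union of the non-bipartite components.\<close>
  define blk where "blk v = (if ?bip v then scc_of v else {})" for v
  have scc_nonempty: "scc_of v \<noteq> {}" for v
    using in_scc_of_self assms(2) by blast
  have range: "range blk = insert {} Q"
  proof -
    \<comment> \<open>A non-bipartite component exists, so the label \<open>{}\<close> occurs; its
      block accounts for the summand 1 in \<open>p + 1\<close>.\<close>
    obtain v where "\<not> ?bip v" using bipartite_of_sccs assms(3) by blast
    then have "{} \<in> range blk" unfolding blk_def by force
    then show ?thesis unfolding blk_def Q_def by (auto simp: image_iff)
  qed
  have arcE: "\<exists>e\<in>arcs G. tail G e = a \<and> head G e = b" if "(a, b) \<in> arcs_ends G" for a b
    using that by (auto simp: arcs_ends_conv)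
  have scc_eq: "scc_of a = scc_of b" if "(a, b) \<in> arcs_ends G" for a b
    using arcE[OF that] scc_of_arc by blast
  have "{H \<in> sccs. bipartite H} = induce_subgraph G ` Q"
    unfolding sccs_conv_sccs_verts sccs_verts_conv_scc_of Q_def assms(2) by blast
  \<comment> \<open>An induced subgraph determines its vertex set, so components can be counted by
    their vertex sets.\<close>
  moreover have "inj_on (induce_subgraph G) Q"
    by (rule inj_onI) (metis induce_subgraph_verts)
  ultimately have p: "p = card Q" unfolding assms(4) by (simp add: card_image)
  have crossing: "\<exists>A. crossing A {e \<in> arcs_ends G. blk (fst e) = q}" if q: "q \<in> Q" for q
  proof -
    have "q \<noteq> {}" "bipartite (G \<restriction> q)" using q scc_nonempty by (auto simp: Q_def)
    then obtain A B where AB: "A \<inter> B = {}" "\<And>e. e \<in> arcs (G \<restriction> q) \<Longrightarrow>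
        (tail G e \<in> A \<and> head G e \<in> B) \<or> (tail G e \<in> B \<and> head G e \<in> A)"
      unfolding bipartite_def by auto
    have "a \<in> A \<longleftrightarrow> b \<notin> A" if ab: "(a, b) \<in> arcs_ends G" "blk a = q" for a b
    proof -
      have "scc_of a = q" using ab(2) \<open>q \<noteq> {}\<close> by (simp add: blk_def split: if_splits)
      then have "a \<in> q" "b \<in> q"
        using in_scc_of_self[of a] in_scc_of_self[of b] scc_eq[OF ab(1)] assms(2) by auto
      then obtain e where "e \<in> arcs (G \<restriction> q)" "tail G e = a" "head G e = b"
        using arcE[OF ab(1)] by auto
      then show ?thesis using AB by blast
    qed
    then show ?thesis unfolding crossing_def by (intro exI[of _ A]) auto
  qed
  let ?T = "{t. packs (arcs_ends G) k t}"
  have "\<exists>apex dirs. conical_on UNIV (2 * k) ?T apex dirs \<and>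
      (\<forall>t. packs (arcs_ends G) k t \<longrightarrow> card Q + 1 \<le> card (dirs t))"
  proof (rule conical_packs[OF _ _ range])
    show "sym (arcs_ends G)" using sym_arcs by (simp add: symmetric_def)
    show "blk a = blk b" if "(a, b) \<in> arcs_ends G" for a b
      using scc_eq[OF that] by (simp add: blk_def)
    show "{} \<notin> Q" using scc_nonempty by (auto simp: Q_def)
    show "finite Q" by (simp add: Q_def)
  qed (rule crossing)
  then obtain apex dirs where con: "conical_on UNIV (2 * k) ?T apex dirs"
    and card: "\<And>t. packs (arcs_ends G) k t \<Longrightarrow> card Q + 1 \<le> card (dirs t)"
    by blast
  \<comment> \<open>The ideal power has to be nonzero for its depth to be meaningful;
    \<open>k\<close> copies of one edge give a monomial in it.\<close>
  obtain e where "e \<in> arcs G" using assms(3) by (rule nonbipartite_has_arc)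
  then have "set_mset (replicate_mset k (tail G e, head G e)) \<subseteq> arcs_ends G"
    by (auto simp: arcs_ends_conv)
  from packsI[OF this order_refl] have "?T \<noteq> {}" by auto
  then have "p + 1 \<le> sdepth (*) degree_component
      (monomial_span {t. Poly_Mapping.lookup t \<in> ?T} :: ('v, 'k) mpoly set)"
    unfolding p by (intro sdepth_ge_of_conical[OF con card]) auto
  then show ?thesis by (simp add: edge_ideal_power)
qed

end
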